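(* Let $p\geq q\geq 1$ and $n$ be integers with $p+q\leq n-1$ and $n\equiv p+q \pmod 2$, and let $G\in\mathcal{G}_{n,p,q}$ be a bipartite digraph. Then $q(G)\geq q(B^5_{n,p,q})$, and equality holds if and only if $G\cong B^5_{n,p,q}$.
   Context: All digraphs are finite and simple (no loops, no multiple arcs). A digraph is strongly connected if for every pair of vertices $u,v$ there is a directed path from $u$ to $v$. A digraph is bipartite if its vertex set is a disjoint union $U\cup W$ such that every arc goes from $U$ to $W$ or from $W$ to $U$. For a digraph $G$ with vertices $v_1,\dots,v_n$, let $A(G)=(a_{ij})$ be the adjacency matrix ($a_{ij}=1$ if $(v_i,v_j)$ is an arc, i.e. an arc from $v_i$ to $v_j$, and $a_{ij}=0$ otherwise), $D(G)=\mathrm{diag}(d_1^+,\dots,d_n^+)$ the diagonal matrix of outdegrees, and $Q(G)=D(G)+A(G)$ the signless Laplacian matrix. The Q-index $q(G)$ is the spectral radius of $Q(G)$, i.e. the largest modulus of its eigenvalues. $\overleftrightarrow{K_{p,q}}$ is the complete bipartite digraph with parts $V_p=\{v_1,\dots,v_p\}$ and $V_q=\{v_{p+1},\dots,v_{p+q}\}$ and with both arcs $(u,v)$ and $(v,u)$ for all $u\in V_p$, $v\in V_q$. $\mathcal{G}_{n,p,q}$ is the set of strongly connected bipartite digraphs on $n$ vertices which contain $\overleftrightarrow{K_{p,q}}$ as a subdigraph (up to isomorphism). $B^5_{n,p,q}$ is the digraph on $\{v_1,\dots,v_n\}$ obtained from $\overleftrightarrow{K_{p,q}}$ by adding the directed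 path $v_1v_{p+q+1}v_{p+q+2}\cdots v_nv_{p+1}$, i.e. adding new vertices $v_{p+q+1},\dots,v_n$ and the arcs $(v_1,v_{p+q+1})$, $(v_i,v_{i+1})$ for $p+q+1\le i\le n-1$, and $(v_n,v_{p+1})$. *)

theory Defs
  imports
    "Graph_Theory.Graph_Theory"
    "Jordan_Normal_Form.Spectral_Radius"
    "HOL-Number_Theory.Cong"
begin

definition bipartite_digraph :: "('a, 'b) pre_digraph \<Rightarrow> bool" where
  "bipartite_digraph G \<longleftrightarrow> (\<exists>U W. verts G = U \<union> W \<and> U \<inter> W = {} \<and>
     (\<forall>e \<in> arcs G. (tail G e \<in> U \<and> head G e \<in> W) \<or> (tail G e \<in> W \<and> head G e \<in> U)))"

text \<open>The list \<open>vs\<close> fixes the numbering \<open>v\<^sub>1, \<dots>, v\<^sub>n\<close> of the vertices by which the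
  rows and columns of the matrices are indexed.\<close>

definition vertex_enum :: "('a, 'b) pre_digraph \<Rightarrow> 'a list \<Rightarrow> bool" where
  "vertex_enum G vs \<longleftrightarrow> distinct vs \<and> set vs = verts G"

definition adjacency_mat :: "('a, 'b) pre_digraph \<Rightarrow> 'a list \<Rightarrow> complex mat" where
  "adjacency_mat G vs = mat (length vs) (length vs)
     (\<lambda>(i, j). if (vs ! i, vs ! j) \<in> arcs_ends G then 1 else 0)"

definition outdegree_mat :: "('a, 'b) pre_digraph \<Rightarrow> 'a list \<Rightarrow> complex mat" where
  "outdegree_mat G vs = mat_diag (length vs) (\<lambda>i. of_nat (out_degree G (vs ! i)))"

definition signless_laplacian :: "('a, 'b) pre_digraph \<Rightarrow> 'a list \<Rightarrow> complex mat" where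
  "signless_laplacian G vs = outdegree_mat G vs + adjacency_mat G vs"

text \<open>The numbering is chosen arbitrarily; \<open>q_index_eq\<close> below shows that the value does not
  depend on the choice.\<close>

definition q_index :: "('a, 'b) pre_digraph \<Rightarrow> real" where
  "q_index G = spectral_radius (signless_laplacian G (SOME vs. vertex_enum G vs))"

lemma vertex_enum_exists:
  assumes "finite (verts G)"
  obtains vs where "vertex_enum G vs"
  using finite_distinct_list[OF assms] that unfolding vertex_enum_def by blast

lemma signless_laplacian_carrier [simp]:
  "signless_laplacian G vs \<in> carrier_mat (length vs) (length vs)"
  by (simp add: signless_laplacian_def outdegree_mat_def adjacency_mat_def)

lemma signless_laplacian_dim [simp]:
  "dim_row (signless_laplacian G vs) = length vs"
  "dim_col (signless_laplacian G vs) = length vs"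
  using carrier_matD[OF signless_laplacian_carrier] by auto

lemma eigenvalue_signless_laplacian_iff:
  assumes "vertex_enum G vs"
  shows "eigenvalue (signless_laplacian G vs) k \<longleftrightarrow>
    (\<exists>f. (\<exists>u \<in> verts G. f u \<noteq> 0) \<and>
      (\<forall>u \<in> verts G. of_nat (out_degree G u) * f u +
        (\<Sum>v \<in> verts G. if (u, v) \<in> arcs_ends G then f v else 0) = k * f u))"
    (is "?L \<longleftrightarrow> ?R")
proof -
  let ?n = "length vs"
  let ?Q = "signless_laplacian G vs"
  have d: "distinct vs" and s: "set vs = verts G"
    using assms by (auto simp: vertex_enum_def)
  have bij: "bij_betw ((!) vs) {0..<?n} (verts G)"
    using bij_betw_nth[OF d refl, of "verts G"] s by (simp add: atLeast0LessThan)
  have mult: "(?Q *\<^sub>v vec ?n (\<lambda>i. f (vs ! i))) $ i =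
      of_nat (out_degree G (vs ! i)) * f (vs ! i) +
      (\<Sum>v \<in> verts G. if (vs ! i, v) \<in> arcs_ends G then f v else 0)"
    if i: "i < ?n" for f :: "'a \<Rightarrow> complex" and i
  proof -
    have "(?Q *\<^sub>v vec ?n (\<lambda>i. f (vs ! i))) $ i =
       (\<Sum>j = 0..<?n. ((if i = j then of_nat (out_degree G (vs ! j)) else 0) +
          (if (vs ! i, vs ! j) \<in> arcs_ends G then 1 else 0)) * f (vs ! j))"
      using i by (auto simp: signless_laplacian_def outdegree_mat_def adjacency_mat_def
          mat_diag_def scalar_prod_def intro!: sum.cong)
    also have "\<dots> = (\<Sum>j = 0..<?n. if i = j then of_nat (out_degree G (vs ! j)) * f (vs ! j) else 0) +
       (\<Sum>j = 0..<?n. if (vs ! i, vs ! j) \<in> arcs_ends G then f (vs ! j) else 0)"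
      unfolding sum.distrib[symmetric] by (intro sum.cong) (auto simp: distrib_right)
    also have "(\<Sum>j = 0..<?n. if (vs ! i, vs ! j) \<in> arcs_ends G then f (vs ! j) else 0) =
       (\<Sum>v \<in> verts G. if (vs ! i, v) \<in> arcs_ends G then f v else 0)"
      by (rule sum.reindex_bij_betw[OF bij])
    finally show ?thesis using i by simp
  qed
  show ?thesis
  proof
    assume ?L
    then obtain x where x: "x \<in> carrier_vec ?n" "x \<noteq> 0\<^sub>v ?n" "?Q *\<^sub>v x = k \<cdot>\<^sub>v x"
      unfolding eigenvalue_def eigenvector_def by auto
    define f where "f u = x $ the_inv_into {0..<?n} ((!) vs) u" for u
    have f: "f (vs ! i) = x $ i" if "i < ?n" for i
      using bij that unfolding f_def
      by (subst the_inv_into_f_f) (auto simp: bij_betw_def)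
    have xf: "x = vec ?n (\<lambda>i. f (vs ! i))"
      using x(1) f by (intro eq_vecI) auto
    have "\<exists>i < ?n. x $ i \<noteq> 0"
    proof (rule ccontr)
      assume "\<not> (\<exists>i < ?n. x $ i \<noteq> 0)"
      then have "x = 0\<^sub>v ?n" using x(1) by (intro eq_vecI) auto
      then show False using x(2) by contradiction
    qed
    then obtain i where "i < ?n" "f (vs ! i) \<noteq> 0" using f by auto
    then have "\<exists>u \<in> verts G. f u \<noteq> 0"
      using s nth_mem[of i vs] by blast
    moreover have "of_nat (out_degree G u) * f u +
        (\<Sum>v \<in> verts G. if (u, v) \<in> arcs_ends G then f v else 0) = k * f u"
      if "u \<in> verts G" for u
    proof -
      obtain i where i: "i < ?n" "u = vs ! i"
        using \<open>u \<in> verts G\<close> s by (metis in_set_conv_nth)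
      have "(?Q *\<^sub>v x) $ i = k * f u"
        using x(1,3) i f by simp
      then show ?thesis
        using mult[OF i(1), of f] i(2) unfolding xf[symmetric] by simp
    qed
    ultimately show ?R by blast
  next
    assume ?R
    then obtain f where f: "\<exists>u \<in> verts G. f u \<noteq> 0"
      "\<And>u. u \<in> verts G \<Longrightarrow> of_nat (out_degree G u) * f u +
        (\<Sum>v \<in> verts G. if (u, v) \<in> arcs_ends G then f v else 0) = k * f u"
      by blast
    define x where "x = vec ?n (\<lambda>i. f (vs ! i))"
    have "?Q *\<^sub>v x = k \<cdot>\<^sub>v x"
    proof (rule eq_vecI)
      fix i assume "i < dim_vec (k \<cdot>\<^sub>v x)"
      then have i: "i < ?n" by (simp add: x_def)
      then have u: "vs ! i \<in> verts G" using s nth_mem by blast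
      have "(?Q *\<^sub>v x) $ i = k * f (vs ! i)"
        unfolding x_def mult[OF i] by (rule f(2)[OF u])
      also have "\<dots> = (k \<cdot>\<^sub>v x) $ i" using i by (simp add: x_def)
      finally show "(?Q *\<^sub>v x) $ i = (k \<cdot>\<^sub>v x) $ i" .
    qed (simp add: x_def)
    moreover have "x \<noteq> 0\<^sub>v ?n"
    proof -
      obtain u where "u \<in> verts G" "f u \<noteq> 0" using f(1) by blast
      then obtain i where i: "i < ?n" "f (vs ! i) \<noteq> 0"
        using s by (metis in_set_conv_nth)
      then have "x $ i \<noteq> 0\<^sub>v ?n $ i" by (simp add: x_def)
      then show ?thesis by metis
    qed
    ultimately show ?L
      unfolding eigenvalue_def eigenvector_def by (intro exI[of _ x]) (simp add: x_def)
  qed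
qed

lemma q_index_eq:
  assumes "vertex_enum G vs"
  shows "q_index G = spectral_radius (signless_laplacian G vs)"
proof -
  have some: "vertex_enum G (SOME ws. vertex_enum G ws)"
    using assms by (rule someI)
  have "eigenvalue (signless_laplacian G (SOME ws. vertex_enum G ws)) k =
      eigenvalue (signless_laplacian G vs) k" for k
    unfolding eigenvalue_signless_laplacian_iff[OF some] eigenvalue_signless_laplacian_iff[OF assms]
    by (rule refl)
  then have "spectrum (signless_laplacian G (SOME ws. vertex_enum G ws)) =
      spectrum (signless_laplacian G vs)"
    unfolding spectrum_def by blast
  then show ?thesis
    unfolding q_index_def spectral_radius_def by (rule arg_cong)
qed

definition complete_bipartite :: "nat \<Rightarrow> nat \<Rightarrow> nat pair_pre_digraph" where
  "complete_bipartite p q = \<lparr> pverts = {1..p + q},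
     parcs = {1..p} \<times> {p + 1..p + q} \<union> {p + 1..p + q} \<times> {1..p} \<rparr>"

definition digraph_class :: "nat \<Rightarrow> nat \<Rightarrow> nat \<Rightarrow> ('a, 'b) pre_digraph set" where
  "digraph_class n p q = {G. digraph G \<and> strongly_connected G \<and> bipartite_digraph G \<and>
     card (verts G) = n \<and>
     (\<exists>H. subgraph H G \<and> digraph_iso H (with_proj (complete_bipartite p q)))}"

text \<open>For \<open>p + q = n\<close> there is no new vertex and the three added sets do not describe a path;
  the definition is meant for \<open>p + q + 1 \<le> n\<close>.\<close>

definition B5 :: "nat \<Rightarrow> nat \<Rightarrow> nat \<Rightarrow> nat pair_pre_digraph" where
  "B5 n p q = \<lparr> pverts = pverts (complete_bipartite p q) \<union> {p + q + 1..n},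
     parcs = parcs (complete_bipartite p q) \<union>
       {(1, p + q + 1)} \<union> {(i, i + 1) | i. p + q + 1 \<le> i \<and> i \<le> n - 1} \<union> {(n, p + 1)} \<rparr>"

end

theory Submission
  imports Defs
begin

text \<open>
  The idea is to compare \<open>G\<close> with the extremal digraph \<open>B\<close> by a test vector. Write \<open>k = n - p - q\<close>,
  which is even and positive, and \<open>Q\<close> for the signless Laplacian. For a strongly connected digraph
  with spectral radius \<open>\<rho>\<close>, a positive vector \<open>x\<close> with \<open>Q x \<ge> c x\<close> shows \<open>c \<le> \<rho>\<close>, and \<open>c = \<rho>\<close> is
  only possible if \<open>Q x = c x\<close> (\<open>q_index_ge\<close>, \<open>qop_eq_of_q_index_eq\<close>).

  The Perron root \<open>c > p + q\<close> of \<open>B\<close> solves an explicit equation, because the outdegree along the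
  added path is 1 and the eigenvector is multiplied by \<open>c - 1\<close> at each step towards the biclique
  (\<open>B5_root_exists\<close>, \<open>B5_eigenvector\<close>, \<open>q_index_B5\<close>).

  In \<open>G\<close> some arc \<open>(a, w)\<close> leaves the biclique. Suppose that \<open>a\<close> lies on the \<open>p\<close>-side \<open>P\<close>. Put the
  values of the Perron vector of \<open>B\<close> on the biclique, with \<open>a\<close> as the distinguished vertex, and
  \<open>(c - 1)\<close> to the power \<open>-d v\<close> at every other vertex \<open>v\<close>, where \<open>d\<close> is the distance to the
  \<open>q\<close>-side. At the biclique vertices other than \<open>a\<close> the inequality \<open>Q x \<ge> c x\<close> is inherited from \<open>B\<close>,
  and outside it holds because each vertex has an out-neighbour one step closer
  (\<open>test_vector_bounds\<close>). At \<open>a\<close> it amounts to \<open>d w \<le> k\<close>. A shortest walk from \<open>w\<close> gives \<open>d w \<le> k + 1\<close> by counting, and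
  \<open>d w\<close> is even because \<open>G\<close> is bipartite (\<open>d_w_le\<close>). Equality of the Q-indices forces \<open>d w = k\<close> and
  excludes all arcs beyond the biclique, \<open>(a, w)\<close> and one out-arc for each outside vertex; this is
  \<open>B\<close> (\<open>q_index_eq_root\<close>, \<open>digraph_iso_B5\<close>).

  If \<open>a\<close> lies on the \<open>q\<close>-side, the same argument applies with \<open>p\<close> and \<open>q\<close> exchanged, since \<open>p \<ge> q\<close>
  makes \<open>c\<close> satisfy the exchanged equation as an inequality, which is strict unless \<open>p = q\<close>
  (\<open>root_swap\<close>).
\<close>

section \<open>The signless Laplacian as an operator on vertex functions\<close>

text \<open>Row \<open>u\<close> of \<open>D + A\<close> applied to \<open>f\<close>: every arc \<open>(u, v)\<close> contributes \<open>f u\<close> through the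
  outdegree and \<open>f v\<close> through the adjacency matrix. Only the arc relation enters.\<close>

definition qop :: "('a \<times> 'a) set \<Rightarrow> ('a \<Rightarrow> 'b::comm_ring_1) \<Rightarrow> 'a \<Rightarrow> 'b" where
  "qop E f u = (\<Sum>v \<in> E `` {u}. f u + f v)"

lemma qop_of_real: "qop E (\<lambda>v. of_real (f v)) u = of_real (qop E f u)"
  by (simp add: qop_def)

lemma qop_scale: "qop E (\<lambda>v. c * f v) u = c * qop E f u"
  by (simp add: qop_def sum_distrib_left distrib_left)

lemma qop_diff: "qop E (\<lambda>v. f v - g v) u = qop E f u - qop E g u"
  unfolding qop_def sum_subtractf[symmetric] by (rule sum.cong) simp_all

lemma qop_mono:
  fixes f :: "'a \<Rightarrow> real"
  assumes "E \<subseteq> V \<times> V" "\<And>v. v \<in> V \<Longrightarrow> f v \<le> g v" "u \<in> V"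
  shows "qop E f u \<le> qop E g u"
  unfolding qop_def using assms by (intro sum_mono) (auto intro!: add_mono)

lemma (in digraph) arcs_ends_subset: "arcs_ends G \<subseteq> verts G \<times> verts G"
  using adj_in_verts by auto

lemma (in digraph) out_degree_eq_card: "out_degree G u = card (arcs_ends G `` {u})"
proof -
  have "arcs_ends G `` {u} = head G ` out_arcs G u"
    by (auto simp: arcs_ends_conv out_arcs_def image_iff)
  moreover have "inj_on (head G) (out_arcs G u)"
    by (rule inj_onI) (auto simp: out_arcs_def arc_to_ends_def intro: no_multi_arcs)
  ultimately show ?thesis
    by (simp add: out_degree_def card_image)
qed

lemma (in digraph) qop_conv:
  fixes f :: "'a \<Rightarrow> 'c::comm_ring_1"
  shows "of_nat (out_degree G u) * f u + (\<Sum>v \<in> verts G. if (u, v) \<in> arcs_ends G then f v else 0) =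
    qop (arcs_ends G) f u"
proof -
  have "verts G \<inter> {v. (u, v) \<in> arcs_ends G} = arcs_ends G `` {u}"
    using arcs_ends_subset by auto
  then show ?thesis
    by (simp add: qop_def sum.distrib out_degree_eq_card sum.If_cases)
qed

lemma (in digraph) eigenvalue_iff_qop:
  assumes "vertex_enum G vs"
  shows "eigenvalue (signless_laplacian G vs) k \<longleftrightarrow>
    (\<exists>f. (\<exists>u \<in> verts G. f u \<noteq> 0) \<and> (\<forall>u \<in> verts G. qop (arcs_ends G) f u = k * f u))"
  unfolding eigenvalue_signless_laplacian_iff[OF assms] qop_conv by (rule refl)

lemma (in digraph) signless_laplacian_mult_vec:
  assumes "vertex_enum G vs"
  shows "signless_laplacian G vs *\<^sub>v vec (length vs) (\<lambda>i. f (vs ! i)) =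
    vec (length vs) (\<lambda>i. qop (arcs_ends G) f (vs ! i))"
proof (rule eq_vecI)
  let ?n = "length vs"
  fix i assume "i < dim_vec (vec (length vs) (\<lambda>i. qop (arcs_ends G) f (vs ! i)))"
  then have i: "i < ?n" by simp
  have bij: "bij_betw ((!) vs) {0..<?n} (verts G)"
    using assms bij_betw_nth[of vs "{..<?n}" "verts G"]
    by (simp add: vertex_enum_def atLeast0LessThan)
  have if_mult: "(if b then y else 0) * z = (if b then y * z else 0)" for b and y z :: complex
    by simp
  have "(signless_laplacian G vs *\<^sub>v vec ?n (\<lambda>i. f (vs ! i))) $ i =
      (\<Sum>j = 0..<?n. (if i = j then of_nat (out_degree G (vs ! j)) * f (vs ! j) else 0) +
        (if (vs ! i, vs ! j) \<in> arcs_ends G then f (vs ! j) else 0))"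
    using i by (auto simp: signless_laplacian_def outdegree_mat_def adjacency_mat_def
        mat_diag_def scalar_prod_def distrib_right if_mult intro!: sum.cong)
  also have "\<dots> = of_nat (out_degree G (vs ! i)) * f (vs ! i) +
      (\<Sum>j = 0..<?n. if (vs ! i, vs ! j) \<in> arcs_ends G then f (vs ! j) else 0)"
    using i by (simp add: sum.distrib)
  also have "(\<Sum>j = 0..<?n. if (vs ! i, vs ! j) \<in> arcs_ends G then f (vs ! j) else 0) =
      (\<Sum>v \<in> verts G. if (vs ! i, v) \<in> arcs_ends G then f v else 0)"
    by (rule sum.reindex_bij_betw[OF bij])
  finally show "(signless_laplacian G vs *\<^sub>v vec ?n (\<lambda>i. f (vs ! i))) $ i =
      vec ?n (\<lambda>i. qop (arcs_ends G) f (vs ! i)) $ i"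
    using i by (simp add: qop_conv)
qed simp

section \<open>Bounds for the Q-index by positive test vectors\<close>

lemma (in digraph) q_index_mem_max:
  assumes "vertex_enum G vs" "verts G \<noteq> {}"
  shows "\<exists>k. eigenvalue (signless_laplacian G vs) k \<and> q_index G = norm k"
    and "\<And>k. eigenvalue (signless_laplacian G vs) k \<Longrightarrow> norm k \<le> q_index G"
proof -
  have n: "0 < length vs" using assms by (auto simp: vertex_enum_def)
  note m = spectral_radius_mem_max[OF signless_laplacian_carrier[of G] n, folded q_index_eq[OF assms(1)]]
  show "\<exists>k. eigenvalue (signless_laplacian G vs) k \<and> q_index G = norm k"
    using m(1) by (auto simp: spectrum_def)
  show "\<And>k. eigenvalue (signless_laplacian G vs) k \<Longrightarrow> norm k \<le> q_index G"
    using m(2) by (auto simp: spectrum_def)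
qed

lemma (in digraph) q_index_le:
  assumes ne: "verts G \<noteq> {}"
    and pos: "\<And>u. u \<in> verts G \<Longrightarrow> 0 < (x u :: real)"
    and le: "\<And>u. u \<in> verts G \<Longrightarrow> qop (arcs_ends G) x u \<le> c * x u"
  shows "q_index G \<le> c"
proof -
  let ?V = "verts G" and ?E = "arcs_ends G"
  obtain vs where vs: "vertex_enum G vs" using vertex_enum_exists finite_verts by blast
  obtain k where k: "eigenvalue (signless_laplacian G vs) k" "q_index G = norm k"
    using q_index_mem_max(1)[OF vs ne] by blast
  then obtain f where f: "\<exists>u \<in> ?V. f u \<noteq> 0" "\<And>u. u \<in> ?V \<Longrightarrow> qop ?E f u = k * f u"
    unfolding eigenvalue_iff_qop[OF vs] by blast
  define R where "R v = norm (f v) / x v" for v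
  \<comment> \<open>The vertex where the eigenfunction is largest relative to \<open>x\<close> bounds \<open>\<bar>k\<bar>\<close>.\<close>
  obtain u where u: "u \<in> ?V" "\<And>v. v \<in> ?V \<Longrightarrow> R v \<le> R u"
  proof -
    have "Max (R ` ?V) \<in> R ` ?V" using ne finite_verts by (intro Max_in) auto
    then obtain u where "u \<in> ?V" "Max (R ` ?V) = R u" by auto
    then show ?thesis using that[of u] finite_verts by (metis Max_ge finite_imageI imageI)
  qed
  have R: "norm (f v) \<le> R u * x v" if "v \<in> ?V" for v
    using u(2)[OF that] pos[OF that] by (simp add: R_def[of v] divide_simps)
  have Ru: "norm (f u) = R u * x u" using pos[OF u(1)] by (simp add: R_def)
  have "0 < R u"
  proof -
    obtain v where v: "v \<in> ?V" "f v \<noteq> 0" using f(1) by blast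
    then have "0 < R v" using pos by (simp add: R_def)
    then show ?thesis using u(2)[OF v(1)] by linarith
  qed
  have "norm k * (R u * x u) = norm (qop ?E f u)"
    by (simp add: f(2)[OF u(1)] norm_mult Ru)
  also have "\<dots> \<le> (\<Sum>v \<in> ?E `` {u}. norm (f u + f v))"
    unfolding qop_def by (rule norm_sum)
  also have "\<dots> \<le> (\<Sum>v \<in> ?E `` {u}. R u * (x u + x v))"
    using arcs_ends_subset R u(1) by (intro sum_mono) (fastforce simp: distrib_left intro: order_trans[OF norm_triangle_ineq add_mono])
  also have "\<dots> = R u * qop ?E x u" unfolding qop_def sum_distrib_left ..
  also have "\<dots> \<le> R u * (c * x u)" using le[OF u(1)] \<open>0 < R u\<close> by simp
  finally have "norm k * (R u * x u) \<le> c * (R u * x u)" by (simp add: mult_ac)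
  then show ?thesis
    using \<open>0 < R u\<close> pos[OF u(1)] k(2) by simp
qed

lemma (in digraph) q_index_eq_of_positive_eigenvector:
  assumes ne: "verts G \<noteq> {}"
    and pos: "\<And>u. u \<in> verts G \<Longrightarrow> 0 < (x u :: real)"
    and eig: "\<And>u. u \<in> verts G \<Longrightarrow> qop (arcs_ends G) x u = c * x u"
  shows "q_index G = c"
proof (rule antisym)
  show "q_index G \<le> c" using q_index_le[OF ne pos] eig by simp
  obtain vs where vs: "vertex_enum G vs" using vertex_enum_exists finite_verts by blast
  have "eigenvalue (signless_laplacian G vs) (of_real c)"
    unfolding eigenvalue_iff_qop[OF vs]
  proof (intro exI[of _ "\<lambda>v. of_real (x v)"] conjI ballI)
    show "\<exists>u \<in> verts G. complex_of_real (x u) \<noteq> 0" using ne pos by fastforce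
  qed (simp add: qop_of_real eig)
  then have "\<bar>c\<bar> \<le> q_index G" using q_index_mem_max(2)[OF vs ne] by fastforce
  then show "c \<le> q_index G" by linarith
qed

text \<open>The lower Collatz-Wielandt bound. If all eigenvalues were smaller in modulus than some
  \<open>b < c\<close>, the powers of \<open>Q / b\<close> would be bounded, whereas \<open>Q\<^sup>m x \<ge> c\<^sup>m x\<close>.\<close>

lemma (in digraph) q_index_ge:
  assumes ne: "verts G \<noteq> {}"
    and pos: "\<And>u. u \<in> verts G \<Longrightarrow> 0 < (x u :: real)"
    and ge: "\<And>u. u \<in> verts G \<Longrightarrow> c * x u \<le> qop (arcs_ends G) x u"
  shows "c \<le> q_index G"
proof (rule ccontr)
  let ?V = "verts G" and ?E = "arcs_ends G"
  assume "\<not> c \<le> q_index G"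
  then obtain b where b: "q_index G < b" "b < c" using dense[of "q_index G" c] by auto
  obtain vs where vs: "vertex_enum G vs" using vertex_enum_exists finite_verts by blast
  let ?n = "length vs" and ?A = "signless_laplacian G vs"
  have mem: "vs ! i \<in> ?V" if "i < ?n" for i
    using vs that nth_mem by (auto simp: vertex_enum_def)
  have n: "0 < ?n" using vs ne by (auto simp: vertex_enum_def)
  have "0 \<le> q_index G" using q_index_mem_max(1)[OF vs ne] by auto
  with b have b0: "0 < b" by linarith
  define B where "B = complex_of_real (1 / b) \<cdot>\<^sub>m ?A"
  have B: "B \<in> carrier_mat ?n ?n" by (simp add: B_def)
  have "spectral_radius B < 1"
  proof -
    obtain k where k: "eigenvalue B k" "spectral_radius B = norm k"
      using spectral_radius_mem_max(1)[OF B n] by (auto simp: spectrum_def)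
    then obtain v where v: "v \<in> carrier_vec ?n" "v \<noteq> 0\<^sub>v ?n" "B *\<^sub>v v = k \<cdot>\<^sub>v v"
      using B unfolding eigenvalue_def eigenvector_def by auto
    have "?A *\<^sub>v v = of_real b \<cdot>\<^sub>v (B *\<^sub>v v)"
      using b0 v(1) by (auto simp: B_def smult_scalar_prod_distrib[OF _ v(1)] intro!: eq_vecI)
    also have "\<dots> = (of_real b * k) \<cdot>\<^sub>v v" by (simp add: v(3) smult_smult_assoc)
    finally have "eigenvalue ?A (of_real b * k)"
      using v unfolding eigenvalue_def eigenvector_def by auto
    then have "norm (of_real b * k) \<le> q_index G" using q_index_mem_max(2)[OF vs ne] by blast
    moreover have "norm (of_real b * k) = b * norm k" using b0 by (simp add: norm_mult)
    ultimately have "b * norm k < b" using b by linarith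
    then show ?thesis using b0 k(2) by simp
  qed
  then obtain C where C: "\<And>m. norm_bound (B ^\<^sub>m m) C"
    using spectral_radius_jnf_norm_bound_less_1_upper_triangular[OF B] by blast
  have C': "norm ((B ^\<^sub>m m) $$ (i, j)) \<le> C" if "i < ?n" "j < ?n" for i j m
    using C[of m] B that pow_carrier_mat[OF B, of m] by (auto simp: norm_bound_def)
  have iter: "B ^\<^sub>m m *\<^sub>v vec ?n (\<lambda>i. f (vs ! i)) =
      vec ?n (\<lambda>i. of_real (1 / b) ^ m * (qop ?E ^^ m) f (vs ! i))" for m and f :: "'a \<Rightarrow> complex"
  proof (induction m arbitrary: f)
    case 0
    show ?case using B by (auto intro!: eq_vecI)
  next
    case (Suc m)
    have "B *\<^sub>v vec ?n (\<lambda>i. f (vs ! i)) = of_real (1 / b) \<cdot>\<^sub>v vec ?n (\<lambda>i. qop ?E f (vs ! i))"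
      unfolding signless_laplacian_mult_vec[OF vs, symmetric] B_def
      by (auto intro!: eq_vecI simp: smult_scalar_prod_distrib[of _ ?n])
    then have "B ^\<^sub>m Suc m *\<^sub>v vec ?n (\<lambda>i. f (vs ! i)) =
        of_real (1 / b) \<cdot>\<^sub>v (B ^\<^sub>m m *\<^sub>v vec ?n (\<lambda>i. qop ?E f (vs ! i)))"
      using B pow_carrier_mat[OF B, of m]
      by (simp add: assoc_mult_mat_vec[of _ ?n ?n _ ?n] mult_mat_vec[of _ ?n ?n])
    also have "\<dots> = of_real (1 / b) \<cdot>\<^sub>v vec ?n (\<lambda>i. of_real (1 / b) ^ m * (qop ?E ^^ Suc m) f (vs ! i))"
      unfolding Suc.IH funpow_Suc_right comp_def ..
    finally show ?case by (auto intro!: eq_vecI)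
  qed
  have of_real_iter: "(qop ?E ^^ m) (\<lambda>v. complex_of_real (x v)) = (\<lambda>v. of_real ((qop ?E ^^ m) x v))" for m
    by (induction m) (auto simp: qop_of_real)
  have growth: "c ^ m * x u \<le> (qop ?E ^^ m) x u" if "u \<in> ?V" for m u
    using that
  proof (induction m arbitrary: u)
    case (Suc m)
    have "c ^ Suc m * x u = c ^ m * (c * x u)" by simp
    also have "\<dots> \<le> c ^ m * qop ?E x u" using ge[OF Suc.prems] b b0 by (intro mult_left_mono) auto
    also have "\<dots> = qop ?E (\<lambda>v. c ^ m * x v) u" by (simp add: qop_scale)
    also have "\<dots> \<le> qop ?E ((qop ?E ^^ m) x) u"
      using Suc by (intro qop_mono[OF arcs_ends_subset]) auto
    finally show ?case by simp
  qed simp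
  define S where "S = (\<Sum>j = 0..<?n. C * x (vs ! j))"
  have "(c / b) ^ m * x (vs ! 0) \<le> S" for m
  proof -
    let ?y = "vec ?n (\<lambda>i. complex_of_real (x (vs ! i)))"
    have "(c / b) ^ m * x (vs ! 0) = (1 / b) ^ m * (c ^ m * x (vs ! 0))"
      by (simp add: power_divide)
    also have "\<dots> \<le> (1 / b) ^ m * (qop ?E ^^ m) x (vs ! 0)"
      using growth[OF mem[OF n]] b0 by (intro mult_left_mono) auto
    also have "\<dots> \<le> norm (complex_of_real ((1 / b) ^ m * (qop ?E ^^ m) x (vs ! 0)))"
      by (simp only: norm_of_real abs_ge_self)
    also have "complex_of_real ((1 / b) ^ m * (qop ?E ^^ m) x (vs ! 0)) = (B ^\<^sub>m m *\<^sub>v ?y) $ 0"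
      using n by (simp add: iter[of m "\<lambda>v. complex_of_real (x v)"] of_real_iter)
    also have "\<dots> = (\<Sum>j = 0..<?n. (B ^\<^sub>m m) $$ (0, j) * complex_of_real (x (vs ! j)))"
      using n B pow_carrier_mat[OF B, of m] by (auto simp: scalar_prod_def intro!: sum.cong)
    also have "norm \<dots> \<le> S"
      unfolding S_def
    proof (intro sum_norm_le)
      fix j assume "j \<in> {0..<?n}"
      then show "norm ((B ^\<^sub>m m) $$ (0, j) * complex_of_real (x (vs ! j))) \<le> C * x (vs ! j)"
        using C'[OF n, of j m] pos[OF mem[of j]] by (simp add: norm_mult mult_right_mono)
    qed
    finally show ?thesis .
  qed
  moreover obtain m where "S / x (vs ! 0) < (c / b) ^ m"
    using real_arch_pow[of "c / b" "S / x (vs ! 0)"] b b0 by auto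
  ultimately show False using pos[OF mem[OF n]]
    by (metis divide_less_eq not_le)
qed

text \<open>For a strongly connected digraph a strict inequality at one vertex forces a strict inequality
  for the spectral radius: applying \<open>Q\<close> often enough to \<open>x\<close> spreads it to all vertices.\<close>

lemma (in digraph) qop_eq_of_q_index_eq:
  assumes sc: "strongly_connected G"
    and out: "\<And>u. u \<in> verts G \<Longrightarrow> arcs_ends G `` {u} \<noteq> {}"
    and pos: "\<And>u. u \<in> verts G \<Longrightarrow> 0 < (x u :: real)"
    and ge: "\<And>u. u \<in> verts G \<Longrightarrow> c * x u \<le> qop (arcs_ends G) x u"
    and q: "q_index G = c" and z: "z \<in> verts G"
  shows "qop (arcs_ends G) x z = c * x z"
proof (rule ccontr)
  let ?V = "verts G" and ?E = "arcs_ends G"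
  assume "qop ?E x z \<noteq> c * x z"
  with ge[OF z] have strict: "c * x z < qop ?E x z" by simp
  have fin: "finite (?E `` {u})" for u
    using finite_verts arcs_ends_subset by (auto intro: finite_subset)
  define X where "X m = (qop ?E ^^ m) x" for m
  define D where "D m u = qop ?E (X m) u - c * X m u" for m u
  have X_Suc: "X (Suc m) u = qop ?E (X m) u" for m u by (simp add: X_def)
  have D_Suc: "D (Suc m) u = qop ?E (D m) u" for m u
  proof -
    have "D (Suc m) u = qop ?E (X (Suc m)) u - c * qop ?E (X m) u" by (simp add: D_def X_Suc)
    also have "X (Suc m) = (\<lambda>v. qop ?E (X m) v)" by (simp add: X_Suc fun_eq_iff)
    finally show ?thesis by (simp add: D_def[abs_def] qop_diff qop_scale)
  qed
  have expand: "g v \<le> qop ?E g u \<and> g u \<le> qop ?E g u"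
    if "\<And>v. v \<in> ?V \<Longrightarrow> 0 \<le> g v" "(u, v) \<in> ?E" for g :: "'a \<Rightarrow> real" and u v
  proof -
    have V: "u \<in> ?V" "v \<in> ?V" using that(2) arcs_ends_subset by auto
    have "g u + g v \<le> qop ?E g u" unfolding qop_def
      using that V arcs_ends_subset fin by (intro member_le_sum[of v _ "\<lambda>v. g u + g v"]) auto
    then show ?thesis using that(1)[OF V(1)] that(1)[OF V(2)] by simp
  qed
  have Xpos: "0 < X m u" if "u \<in> ?V" for m u
    using that
  proof (induction m arbitrary: u)
    case (Suc m)
    obtain v where v: "(u, v) \<in> ?E" using out[OF Suc.prems] by blast
    show ?case using expand[of "X m" u v] v Suc X_Suc by (metis less_eq_real_def less_le_trans)
  qed (use pos in \<open>simp add: X_def\<close>)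
  have Dnn: "0 \<le> D m u" if "u \<in> ?V" for m u
    using that
  proof (induction m arbitrary: u)
    case (Suc m)
    obtain v where v: "(u, v) \<in> ?E" using out[OF Suc.prems] by blast
    show ?case using expand[of "D m" u v] v Suc D_Suc by (metis order_trans)
  qed (use ge in \<open>simp add: X_def D_def\<close>)
  have Dmono: "D m u \<le> D (m + l) u" if u: "u \<in> ?V" for m l u
  proof (induction l)
    case (Suc l)
    obtain v where v: "(u, v) \<in> ?E" using out[OF u] by blast
    show ?case using expand[of "D (m + l)" u v, OF Dnn v] Suc by (simp add: D_Suc)
  qed simp
  have "\<exists>m. 0 < D m u" if "u \<in> ?V" for u
  proof -
    have "u \<rightarrow>\<^sup>* z" using sc that z by (auto simp: strongly_connected_def)
    then show ?thesis
    proof (induction rule: converse_reachable_induct)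
      case base
      then show ?case using strict by (intro exI[of _ 0]) (simp add: D_def X_def)
    next
      case (step u v)
      then obtain m where "0 < D m v" by blast
      then have "0 < D (Suc m) u" using expand[of "D m" u v, OF Dnn step(1)] by (simp add: D_Suc)
      then show ?case by blast
    qed
  qed
  then obtain M where M: "\<And>u. u \<in> ?V \<Longrightarrow> 0 < D (M u) u" by metis
  define N where "N = Max (M ` ?V)"
  have DN: "0 < D N u" if "u \<in> ?V" for u
  proof -
    have "M u \<le> N" using that finite_verts by (simp add: N_def)
    then show ?thesis using M[OF that] Dmono[OF that, of "M u" "N - M u"] by simp
  qed
  define e where "e = Min ((\<lambda>u. D N u / X N u) ` ?V)"
  have ne: "?V \<noteq> {}" using z by blast
  have "0 < e" unfolding e_def using ne finite_verts DN Xpos by (subst Min_gr_iff) auto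
  have "(c + e) * X N u \<le> qop ?E (X N) u" if "u \<in> ?V" for u
  proof -
    have "e \<le> D N u / X N u" unfolding e_def using that finite_verts by (intro Min_le) auto
    then have "e * X N u \<le> D N u" using Xpos[OF that, of N] by (simp add: field_simps)
    then show ?thesis by (simp add: D_def algebra_simps)
  qed
  then have "c + e \<le> q_index G" by (intro q_index_ge[OF ne Xpos]) auto
  then show False using q \<open>0 < e\<close> by simp
qed

section \<open>Isomorphisms onto digraphs on arc pairs\<close>

lemma (in digraph) digraph_iso_with_projI:
  assumes bij: "bij_betw f (verts G) (pverts H)"
    and sub: "parcs H \<subseteq> pverts H \<times> pverts H"
    and arcs: "\<And>u v. u \<in> verts G \<Longrightarrow> v \<in> verts G \<Longrightarrow> (u, v) \<in> arcs_ends G \<longleftrightarrow> (f u, f v) \<in> parcs H"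
  shows "digraph_iso G (with_proj H)"
proof -
  define hom where "hom = \<lparr>iso_verts = f, iso_arcs = (\<lambda>e. (f (tail G e), f (head G e))),
    iso_head = snd, iso_tail = fst\<rparr>"
  have inj: "inj_on f (verts G)" and img: "f ` verts G = pverts H"
    using bij by (auto simp: bij_betw_def)
  have "inj_on (iso_arcs hom) (arcs G)"
  proof (rule inj_onI)
    fix e1 e2 assume e: "e1 \<in> arcs G" "e2 \<in> arcs G" "iso_arcs hom e1 = iso_arcs hom e2"
    then have "tail G e1 = tail G e2" "head G e1 = head G e2"
      using inj by (auto simp: hom_def dest: inj_onD)
    then show "e1 = e2" using e no_multi_arcs by (simp add: arc_to_ends_def)
  qed
  then have iso: "digraph_isomorphism hom"
    using inj wf_digraph by (simp add: digraph_isomorphism_def hom_def)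
  have "iso_arcs hom ` arcs G = (\<lambda>(u, v). (f u, f v)) ` arcs_ends G"
    by (auto simp: hom_def arcs_ends_conv image_image)
  also have "\<dots> = parcs H"
  proof (intro equalityI subsetI)
    fix e assume "e \<in> (\<lambda>(u, v). (f u, f v)) ` arcs_ends G"
    then obtain u v where uv: "(u, v) \<in> arcs_ends G" "e = (f u, f v)" by auto
    then show "e \<in> parcs H" using arcs[of u v] adj_in_verts[OF uv(1)] by blast
  next
    fix e assume e: "e \<in> parcs H"
    then have "e \<in> (f ` verts G) \<times> (f ` verts G)" using sub img by blast
    then obtain u v where uv: "u \<in> verts G" "v \<in> verts G" "e = (f u, f v)" by auto
    then have "(u, v) \<in> arcs_ends G" using arcs[OF uv(1,2)] e by simp
    then show "e \<in> (\<lambda>(u, v). (f u, f v)) ` arcs_ends G" using uv(3) by (auto intro: rev_image_eqI)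
  qed
  finally have "app_iso hom G = with_proj H"
    using img by (simp add: app_iso_def with_proj_def hom_def)
  then show ?thesis using iso unfolding digraph_iso_def by (intro exI[of _ hom]) simp
qed

lemma digraph_iso_with_projE:
  assumes "digraph_iso G (with_proj H)"
  obtains f where "bij_betw f (verts G) (pverts H)"
    "parcs H = (\<lambda>(u, v). (f u, f v)) ` arcs_ends G"
proof -
  obtain hom where hom: "pre_digraph.digraph_isomorphism G hom" "with_proj H = app_iso hom G"
    using assms by (auto simp: digraph_iso_def)
  have "bij_betw (iso_verts hom) (verts G) (pverts H)"
    using hom(2) pre_digraph.digraph_isomorphism_inj_on_verts[OF hom(1)]
    by (metis bij_betw_def verts_app_iso with_proj_simps(1))
  moreover have "parcs H = (\<lambda>(u, v). (iso_verts hom u, iso_verts hom v)) ` arcs_ends G"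
    using hom(2) wf_digraph.arcs_ends_app_iso_eq[OF _ hom(1)] hom(1)
    by (metis pre_digraph.digraph_isomorphism_def with_proj_simps(3))
  ultimately show ?thesis using that by blast
qed

lemma (in digraph) q_index_eq_of_iso:
  assumes iso: "digraph_iso G (with_proj H)"
    and ne: "pverts H \<noteq> {}"
    and pos: "\<And>i. i \<in> pverts H \<Longrightarrow> 0 < (x i :: real)"
    and eig: "\<And>i. i \<in> pverts H \<Longrightarrow> qop (parcs H) x i = c * x i"
  shows "q_index G = c"
proof -
  obtain f where f: "bij_betw f (verts G) (pverts H)"
    and H: "parcs H = (\<lambda>(u, v). (f u, f v)) ` arcs_ends G"
    using digraph_iso_with_projE[OF iso] .
  have inj: "inj_on f (verts G)" and img: "f ` verts G = pverts H"
    using f by (auto simp: bij_betw_def)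
  show ?thesis
  proof (rule q_index_eq_of_positive_eigenvector[of "x \<circ> f"])
    show "verts G \<noteq> {}" using img ne by auto
    show "0 < (x \<circ> f) u" if "u \<in> verts G" for u using pos img that by auto
    fix u assume u: "u \<in> verts G"
    have sub: "arcs_ends G `` {u} \<subseteq> verts G" using arcs_ends_subset by auto
    have "parcs H `` {f u} = f ` (arcs_ends G `` {u})"
      using inj u arcs_ends_subset unfolding H by (auto simp: image_iff dest: inj_onD)
    then have "qop (parcs H) x (f u) = qop (arcs_ends G) (x \<circ> f) u"
      unfolding qop_def by (simp add: sum.reindex[OF inj_on_subset[OF inj sub]])
    then show "qop (arcs_ends G) (x \<circ> f) u = c * (x \<circ> f) u"
      using eig[of "f u"] img u by auto
  qed
qed

section \<open>The Q-index of the extremal digraph\<close>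

text \<open>With \<open>k = n - p - q\<close>, this is the equation that the Perron root \<open>c\<close> of \<open>B5 n p q\<close> satisfies
  after the values on the biclique are eliminated; the last summand is the contribution of the
  added path, along which the eigenvector is multiplied by \<open>c - 1\<close> at each step.\<close>

lemma B5_root_exists:
  assumes "1 \<le> p" "1 \<le> q"
  obtains c :: real where "real p + real q < c"
    "(c - q - 1) * (c * (c - p - q)) = q + (1 / (c - 1)) ^ k * (c - q)"
proof -
  define F :: "real \<Rightarrow> real" where "F c = (c - q - 1) * (c * (c - p - q)) - q - (1 / (c - 1)) ^ k * (c - real q)" for c
  let ?l = "real p + real q" and ?u = "real p + real q + 1"
  have p1: "1 \<le> real p" and q1: "1 \<le> real q" using assms by auto
  have "0 \<le> (1 / (?l - 1)) ^ k * real p" using p1 q1 by (intro mult_nonneg_nonneg) auto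
  moreover have "F ?l = - q - (1 / (?l - 1)) ^ k * real p" by (simp add: F_def)
  ultimately have lo: "F ?l < 0" using q1 by linarith
  have "(1 / (?u - 1)) ^ k * (real p + 1) \<le> 1 * (real p + 1)"
    using p1 q1 by (intro mult_right_mono power_le_one) auto
  moreover have "real p + 1 + real q \<le> real p * (real p + real q + 1)"
  proof -
    have "1 \<le> real p * real p" using mult_mono[OF p1 p1] by simp
    moreover have "real q \<le> real p * real q" using mult_right_mono[OF p1, of "real q"] by simp
    ultimately show ?thesis by (simp add: algebra_simps)
  qed
  ultimately have hi: "0 \<le> F ?u" by (simp add: F_def algebra_simps)
  have "continuous_on {?l..?u} F"
    unfolding F_def using p1 q1 by (intro continuous_intros) auto
  then obtain c where c: "?l \<le> c" "F c = 0"
    using IVT'[of F ?l 0 ?u] lo hi by auto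
  then have "?l < c" using lo by (cases "c = ?l") auto
  then show ?thesis using that[of c] c by (simp add: F_def)
qed

text \<open>The corresponding eigenvector, normalised to 1 on the \<open>q\<close>-side \<open>{p + 1..p + q}\<close>. The vertices
  \<open>p + q + 1, \<dots>, p + q + k\<close> of the path are at distances \<open>k, \<dots>, 1\<close> from that side.\<close>

definition B5_vector :: "nat \<Rightarrow> nat \<Rightarrow> nat \<Rightarrow> real \<Rightarrow> nat \<Rightarrow> real" where
  "B5_vector k p q c i = (if i = 1 then (q + (1 / (c - 1)) ^ k) / (c - q - 1)
     else if i \<le> p then q / (c - q) else if i \<le> p + q then 1
     else (1 / (c - 1)) ^ (p + q + k + 1 - i))"

text \<open>The defect in the eigenvalue equation, cleared of denominators, at the vertices on the
  \<open>q\<close>-side, which see the distinguished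
  vertex with value \<open>(q + e) / (c - q - 1)\<close> and \<open>p - 1\<close> vertices with value \<open>q / (c - q)\<close>.\<close>

lemma biclique_equation:
  fixes p q c e :: real
  assumes "q + 1 < c"
  shows "(c - q - 1) * (c - q) * (p + (q + e) / (c - q - 1) + (p - 1) * (q / (c - q)) - c) =
    q + e * (c - q) - (c - q - 1) * (c * (c - p - q))"
proof -
  define r s where "r = (q + e) / (c - q - 1)" and "s = q / (c - q)"
  have r: "(c - q - 1) * r = q + e" and s: "(c - q) * s = q"
    using assms by (auto simp: r_def s_def)
  have "(c - q - 1) * (c - q) * (p + r + (p - 1) * s - c) =
      (c - q - 1) * (c - q) * (p - c) + (c - q) * ((c - q - 1) * r) + (c - q - 1) * (p - 1) * ((c - q) * s)"
    by (simp add: algebra_simps)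
  also have "\<dots> = q + e * (c - q) - (c - q - 1) * (c * (c - p - q))"
    unfolding r s by (simp add: algebra_simps)
  finally show ?thesis unfolding r_def s_def .
qed

lemma sum_add_const: "finite A \<Longrightarrow> (\<Sum>v\<in>A. b + g v) = real (card A) * b + sum g A"
  by (simp add: sum.distrib)

lemma sum_biclique_side:
  fixes x :: "'a \<Rightarrow> real"
  assumes "finite A" "a \<in> A" "\<And>v. v \<in> A - {a} \<Longrightarrow> x v = y"
  shows "sum x A = x a + (real (card A) - 1) * y"
proof -
  have "sum x A = x a + sum x (A - {a})" using assms by (simp add: sum.remove)
  also have "sum x (A - {a}) = real (card (A - {a})) * y" using assms(3) by simp
  also have "real (card (A - {a})) = real (card A) - 1"
    using assms(1,2) card_gt_0_iff[of A] by (auto simp: of_nat_diff)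
  finally show ?thesis .
qed

lemma pverts_B5: "pverts (B5 (p + q + k) p q) = {1..p + q + k}"
  by (auto simp: B5_def complete_bipartite_def)

lemma B5_arcs_iff:
  "(i, j) \<in> parcs (B5 (p + q + k) p q) \<longleftrightarrow>
     i \<in> {1..p} \<and> j \<in> {p + 1..p + q} \<or> i \<in> {p + 1..p + q} \<and> j \<in> {1..p} \<or>
     i = 1 \<and> j = p + q + 1 \<or> p + q + 1 \<le> i \<and> i \<le> p + q + k - 1 \<and> j = i + 1 \<or>
     i = p + q + k \<and> j = p + 1"
  by (auto simp: B5_def complete_bipartite_def)

lemma B5_eigenvector:
  assumes p: "1 \<le> p" and q: "1 \<le> q" and k: "1 \<le> k"
    and c: "real p + real q < c"
    and root: "(c - q - 1) * (c * (c - p - q)) = q + (1 / (c - 1)) ^ k * (c - q)"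
    and i: "i \<in> pverts (B5 (p + q + k) p q)"
  shows "0 < B5_vector k p q c i"
    and "qop (parcs (B5 (p + q + k) p q)) (B5_vector k p q c) i = c * B5_vector k p q c i"
proof -
  let ?x = "B5_vector k p q c" and ?E = "parcs (B5 (p + q + k) p q)" and ?t = "1 / (c - 1)"
  have p1: "1 \<le> real p" and q1: "1 \<le> real q" using p q by auto
  have pos: "0 < c - q - 1" "0 < c - q" "0 < c - 1" using c p1 q1 by auto
  have "0 < ?t ^ k" using pos by simp
  then show "0 < ?x i" using pos q1 by (auto simp: B5_vector_def intro!: divide_pos_pos add_pos_pos)
  have x1: "?x 1 = (q + ?t ^ k) / (c - q - 1)" by (simp add: B5_vector_def)
  have xP: "?x j = q / (c - q)" if "j \<in> {1..p} - {1}" for j using that by (simp add: B5_vector_def)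
  have xQ: "?x j = 1" if "j \<in> {p + 1..p + q}" for j using that p by (simp add: B5_vector_def)
  have xR: "?x j = ?t ^ (p + q + k + 1 - j)" if "p + q + 1 \<le> j" for j
    using that p by (simp add: B5_vector_def)
  have sumP: "sum ?x {1..p} = ?x 1 + (real p - 1) * (q / (c - q))"
    using sum_biclique_side[of "{1..p}" 1 ?x, OF _ _ xP] p by simp
  have sumQ: "sum ?x {p + 1..p + q} = q" using sum.cong[OF refl xQ, of "{p + 1..p + q}"] by simp
  consider "i = 1" | "2 \<le> i" "i \<le> p" | "p + 1 \<le> i" "i \<le> p + q" | "p + q + 1 \<le> i" "i < p + q + k"
    | "i = p + q + k"
    using i unfolding pverts_B5 by fastforce
  then show "qop ?E ?x i = c * ?x i"
  proof cases
    case 1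
    have "?E `` {i} = insert (p + q + 1) {p + 1..p + q}" using 1 p q k by (auto simp: B5_arcs_iff)
    then have "qop ?E ?x i = (q + 1) * ?x i + (?x (p + q + 1) + sum ?x {p + 1..p + q})"
      unfolding qop_def by (subst sum_add_const) auto
    also have "\<dots> = (q + 1) * ?x 1 + (?t ^ k + q)" using sumQ xR[of "p + q + 1"] 1 by simp
    finally have "qop ?E ?x i = (q + 1) * ?x 1 + (?t ^ k + q)" .
    moreover have "(c - q - 1) * ?x 1 = q + ?t ^ k" using pos(1) unfolding x1 by simp
    ultimately show ?thesis using 1 by (simp add: algebra_simps)
  next
    case 2
    have "?E `` {i} = {p + 1..p + q}" using 2 q k by (auto simp: B5_arcs_iff)
    then have "qop ?E ?x i = q * ?x i + q"
      unfolding qop_def using sumQ by (subst sum_add_const) auto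
    moreover have "(c - q) * ?x i = q" using 2 pos(2) xP[of i] by simp
    ultimately show ?thesis by (simp add: algebra_simps)
  next
    case 3
    have "?E `` {i} = {1..p}" using 3 p k by (auto simp: B5_arcs_iff)
    then have "qop ?E ?x i = p + (?x 1 + (real p - 1) * (q / (c - q)))"
      unfolding qop_def using sumP xQ[of i] 3 by (subst sum_add_const) auto
    moreover have "p + ?x 1 + (real p - 1) * (q / (c - q)) - c = 0"
      using biclique_equation[of q c p "?t ^ k"] pos root unfolding x1 by auto
    ultimately show ?thesis using xQ[of i] 3 by simp
  next
    case 4
    have "?E `` {i} = {i + 1}" using 4 p q by (auto simp: B5_arcs_iff)
    then have "qop ?E ?x i = ?x i + ?x (i + 1)" by (simp add: qop_def)
    moreover have "p + q + k + 1 - i = Suc (p + q + k - i)" using 4 by simp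
    then have "(c - 1) * ?x i = ?x (i + 1)" using pos 4 xR[of i] xR[of "i + 1"] by simp
    ultimately show ?thesis by (simp add: algebra_simps)
  next
    case 5
    have "?E `` {i} = {p + 1}" using 5 p q k by (auto simp: B5_arcs_iff)
    then have "qop ?E ?x i = ?x i + 1" using q xQ[of "p + 1"] by (simp add: qop_def)
    moreover have "(c - 1) * ?x i = 1" using pos 5 k xR[of i] by simp
    ultimately show ?thesis by (simp add: algebra_simps)
  qed
qed

lemma digraph_B5:
  assumes "1 \<le> p" "1 \<le> q" "1 \<le> k"
  shows "digraph (with_proj (B5 (p + q + k) p q))"
proof -
  let ?H = "B5 (p + q + k) p q"
  have sub: "parcs ?H \<subseteq> pverts ?H \<times> pverts ?H"
    using assms unfolding pverts_B5 by (auto simp: B5_arcs_iff)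
  have "finite (parcs ?H)" by (rule finite_subset[OF sub]) (simp add: pverts_B5)
  then show ?thesis
    using sub assms by unfold_locales (auto simp: pverts_B5 B5_arcs_iff arc_to_ends_def)
qed

lemma q_index_B5:
  assumes "1 \<le> p" "1 \<le> q" "1 \<le> k" "real p + real q < c"
    "(c - q - 1) * (c * (c - p - q)) = q + (1 / (c - 1)) ^ k * (c - q)"
  shows "q_index (with_proj (B5 (p + q + k) p q)) = c"
proof (rule digraph.q_index_eq_of_positive_eigenvector[OF digraph_B5, where x = "B5_vector k p q c"])
  let ?H = "with_proj (B5 (p + q + k) p q)"
  show "verts ?H \<noteq> {}" using assms(1) by (simp add: pverts_B5)
  fix i assume "i \<in> verts ?H"
  then have i: "i \<in> pverts (B5 (p + q + k) p q)" by simp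
  show "0 < B5_vector k p q c i" by (rule B5_eigenvector(1)[OF assms i])
  show "qop (arcs_ends ?H) (B5_vector k p q c) i = c * B5_vector k p q c i"
    unfolding with_proj_simps by (rule B5_eigenvector(2)[OF assms i])
qed (use assms in auto)

text \<open>When the exit arc starts on the \<open>q\<close>-side, the roles of \<open>p\<close> and \<open>q\<close> are exchanged in the
  equation for the Perron root. The root of the original equation satisfies the exchanged one as an
  inequality, which is strict for \<open>q < p\<close>.\<close>

lemma root_swap:
  fixes p q c e :: real
  assumes c: "p + q < c" and q: "1 \<le> q" and pq: "q \<le> p" and e: "0 < e"
    and root: "(c - q - 1) * (c * (c - p - q)) = q + e * (c - q)"
  shows "(c - p - 1) * (c * (c - q - p)) \<le> p + e * (c - p)"
    and "(c - p - 1) * (c * (c - q - p)) = p + e * (c - p) \<Longrightarrow> p = q"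
proof -
  let ?X = "c * (c - p - q)"
  have pos: "0 < c - q - 1" using c q pq by simp
  have "(c - q - 1) * (p + e * (c - p) - (c - p - 1) * ?X) =
      (c - q - 1) * (p + e * (c - p)) - (c - p - 1) * ((c - q - 1) * ?X)"
    by (simp add: algebra_simps)
  also have "\<dots> = (p - q) * (c - 1 + e)" unfolding root by (simp add: algebra_simps)
  finally have *: "(c - q - 1) * (p + e * (c - p) - (c - p - 1) * ?X) = (p - q) * (c - 1 + e)" .
  have X: "c * (c - q - p) = ?X" by (simp add: algebra_simps)
  have "0 \<le> (p - q) * (c - 1 + e)" using pq e pos q by (intro mult_nonneg_nonneg) auto
  then have "0 \<le> (c - q - 1) * (p + e * (c - p) - (c - p - 1) * ?X)" using * by simp
  then show "(c - p - 1) * (c * (c - q - p)) \<le> p + e * (c - p)"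
    unfolding X using pos by (simp add: zero_le_mult_iff)
  assume "(c - p - 1) * (c * (c - q - p)) = p + e * (c - p)"
  then have "(p - q) * (c - 1 + e) = 0" using * unfolding X by simp
  then show "p = q" using e pos q by simp
qed

section \<open>Distance to a set of vertices\<close>

text \<open>The length of a shortest walk from \<open>v\<close> into \<open>T\<close>. It is an unspecified number if there is no such
  walk, so reachability appears as a hypothesis below.\<close>

definition steps_to :: "('a \<times> 'a) set \<Rightarrow> 'a set \<Rightarrow> 'a \<Rightarrow> nat" where
  "steps_to E T v = (LEAST m. \<exists>t\<in>T. (v, t) \<in> E ^^ m)"

lemma steps_to_relpow:
  assumes "\<exists>t\<in>T. (v, t) \<in> E\<^sup>*"
  shows "\<exists>t\<in>T. (v, t) \<in> E ^^ steps_to E T v"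
  unfolding steps_to_def by (rule LeastI_ex) (use assms rtrancl_power in blast)

lemma steps_to_leI: "t \<in> T \<Longrightarrow> (v, t) \<in> E ^^ m \<Longrightarrow> steps_to E T v \<le> m"
  unfolding steps_to_def by (rule Least_le) blast

lemma steps_to_eq_0_iff:
  assumes "\<exists>t\<in>T. (v, t) \<in> E\<^sup>*"
  shows "steps_to E T v = 0 \<longleftrightarrow> v \<in> T"
  using steps_to_relpow[OF assms] steps_to_leI[of v T v 0 E] by auto

lemma steps_to_le_Suc:
  assumes "(v, v') \<in> E" "\<exists>t\<in>T. (v', t) \<in> E\<^sup>*"
  shows "steps_to E T v \<le> Suc (steps_to E T v')"
proof -
  obtain t where "t \<in> T" "(v', t) \<in> E ^^ steps_to E T v'" using steps_to_relpow[OF assms(2)] by blast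
  then show ?thesis using assms(1) by (intro steps_to_leI relpow_Suc_I2)
qed

lemma steps_to_Suc_obtains:
  assumes "\<exists>t\<in>T. (v, t) \<in> E\<^sup>*" "steps_to E T v = Suc m"
  obtains v' where "(v, v') \<in> E" "steps_to E T v' = m"
proof -
  obtain t where t: "t \<in> T" "(v, t) \<in> E ^^ Suc m" using steps_to_relpow[OF assms(1)] assms(2) by metis
  then obtain v' where v': "(v, v') \<in> E" "(v', t) \<in> E ^^ m" by (metis relpow_Suc_D2)
  have "steps_to E T v \<le> Suc (steps_to E T v')"
    using v' t(1) by (intro steps_to_le_Suc) (auto intro: relpow_imp_rtrancl)
  moreover have "steps_to E T v' \<le> m" using t(1) v'(2) by (rule steps_to_leI)
  ultimately show ?thesis using that v'(1) assms(2) by force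
qed

section \<open>A biclique with an exit arc in a strongly connected bipartite digraph\<close>

text \<open>\<open>P\<close> and \<open>Q\<close> are the sides of a complete bipartite subdigraph, and the arc \<open>(a, w)\<close> leaves it
  from \<open>P\<close>. The number \<open>k\<close> of remaining vertices is even.\<close>

locale biclique_exit = digraph G for G :: "('a, 'b) pre_digraph" (structure) +
  fixes P Q :: "'a set" and a w :: 'a and p q k :: nat
  assumes sc: "strongly_connected G"
    and bip: "bipartite_digraph G"
    and sides: "P \<union> Q \<subseteq> verts G" "P \<inter> Q = {}"
    and card_sides: "card P = p" "card Q = q"
    and q_pos: "1 \<le> q"
    and biclique: "\<And>u v. u \<in> P \<Longrightarrow> v \<in> Q \<Longrightarrow> (u, v) \<in> arcs_ends G \<and> (v, u) \<in> arcs_ends G"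
    and exit: "a \<in> P" "(a, w) \<in> arcs_ends G" "w \<notin> P \<union> Q"
    and card_verts: "card (verts G) = p + q + k"
    and even_k: "even k"
begin

abbreviation "V \<equiv> verts G"
abbreviation "E \<equiv> arcs_ends G"
abbreviation "R \<equiv> verts G - (P \<union> Q)"
abbreviation d :: "'a \<Rightarrow> nat" where "d \<equiv> steps_to E Q"

lemma finite_sides: "finite P" "finite Q"
  using sides finite_verts by (auto intro: finite_subset)

lemma p_pos: "1 \<le> p"
  using exit(1) card_sides(1) finite_sides(1) card_gt_0_iff[of P] by force

lemma Q_nonempty: "\<exists>b. b \<in> Q"
  using q_pos card_sides(2) by (metis card.empty equals0I not_one_le_zero)

lemma w_R: "w \<in> R"
  using exit adj_in_verts by blast

lemma card_R: "card R = k"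
  using card_verts card_sides card_Un_disjoint[OF finite_sides sides(2)] sides(1) finite_sides
  by (simp add: card_Diff_subset)

lemma k_pos: "1 \<le> k"
proof -
  have "R \<noteq> {}" "finite R" using w_R finite_verts by auto
  then show ?thesis using card_R card_gt_0_iff[of R] by linarith
qed

lemma reach: "u \<in> V \<Longrightarrow> v \<in> V \<Longrightarrow> (u, v) \<in> E\<^sup>*"
  using sc reachable_rtranclI by (metis strongly_connected_def)

lemma reach_Q: "v \<in> V \<Longrightarrow> \<exists>t\<in>Q. (v, t) \<in> E\<^sup>*"
  using Q_nonempty reach sides by blast

lemma d_eq_0_iff: "v \<in> V \<Longrightarrow> d v = 0 \<longleftrightarrow> v \<in> Q"
  using steps_to_eq_0_iff reach_Q by metis

lemma d_Q: "v \<in> Q \<Longrightarrow> d v = 0"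
  using d_eq_0_iff sides by blast

lemma d_P:
  assumes "v \<in> P"
  shows "d v = 1"
proof -
  obtain b where b: "b \<in> Q" using Q_nonempty by blast
  have "d v \<le> Suc (d b)"
    using biclique[OF assms b] b by (intro steps_to_le_Suc) auto
  moreover have "d v \<noteq> 0" using assms sides d_eq_0_iff by blast
  ultimately show ?thesis using d_Q[OF b] by simp
qed

lemma d_R: "v \<in> R \<Longrightarrow> 1 \<le> d v"
  using d_eq_0_iff[of v] by auto

lemma step_exists:
  assumes "v \<in> V" "v \<notin> Q"
  obtains v' where "(v, v') \<in> E" "Suc (d v') = d v"
  using assms d_eq_0_iff steps_to_Suc_obtains[OF reach_Q] by (metis not0_implies_Suc)

lemma even_d_w: "even (d w)"
proof -
  obtain U where U: "\<And>u v. (u, v) \<in> E \<Longrightarrow> (u \<in> U) \<noteq> (v \<in> U)"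
  proof -
    obtain U W where "U \<inter> W = {}"
      "\<forall>e \<in> arcs G. (tail G e \<in> U \<and> head G e \<in> W) \<or> (tail G e \<in> W \<and> head G e \<in> U)"
      using bip unfolding bipartite_digraph_def by blast
    then show ?thesis using that[of U] by (fastforce simp: arcs_ends_conv)
  qed
  have parity: "(v \<in> U) = ((a \<in> U) \<noteq> even (d v))" if "v \<in> V" "d v = m" for v m
    using that
  proof (induction m arbitrary: v)
    case 0
    then have "v \<in> Q" using d_eq_0_iff by blast
    then show ?case using U biclique[OF exit(1)] 0 by auto
  next
    case (Suc m)
    then have "v \<notin> Q" using d_Q by force
    then obtain v' where "(v, v') \<in> E" "Suc (d v') = d v" using step_exists Suc.prems(1) by blast
    then show ?case using Suc U[of v v'] adj_in_verts(2)[of v v'] by (metis even_Suc nat.inject)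
  qed
  show ?thesis using parity[of w] U[OF exit(2)] w_R by blast
qed

text \<open>A shortest walk from \<open>w\<close> to \<open>Q\<close> meets every distance, and vertices of \<open>P\<close> and \<open>Q\<close> only
  account for the distances 0 and 1; so \<open>d w \<le> k + 1\<close>, and parity excludes \<open>k + 1\<close>.\<close>

lemma d_w_le: "d w \<le> k"
proof -
  have hit: "\<exists>u \<in> V. d u = m" if "v \<in> V" "m \<le> d v" for v m
    using that
  proof (induction "d v" arbitrary: v)
    case 0
    then show ?case by auto
  next
    case (Suc l)
    show ?case
    proof (cases "m = d v")
      case False
      have "v \<notin> Q" using Suc.hyps(2) d_Q by force
      then obtain v' where v': "(v, v') \<in> E" "Suc (d v') = d v" using step_exists Suc.prems(1) by blast
      then show ?thesis using Suc False adj_in_verts(2)[OF v'(1)] by (metis Suc_inject le_Suc_eq)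
    qed (use Suc.prems in blast)
  qed
  have "{2..d w} \<subseteq> d ` R"
  proof
    fix m assume m: "m \<in> {2..d w}"
    then obtain u where "u \<in> V" "d u = m" using hit[of w m] w_R by auto
    then show "m \<in> d ` R" using m d_P d_Q by force
  qed
  then have "card {2..d w} \<le> card R"
    using finite_verts by (metis card_image_le card_mono finite_Diff finite_imageI order_trans)
  then have "d w \<le> k + 1" using card_R by simp
  then show ?thesis using even_d_w even_k by (cases "d w = k + 1") auto
qed

text \<open>A chosen out-neighbour one step closer to \<open>Q\<close>.\<close>

definition nxt :: "'a \<Rightarrow> 'a" where
  "nxt v = (SOME v'. (v, v') \<in> E \<and> Suc (d v') = d v)"

lemma nxt: "v \<in> V \<Longrightarrow> v \<notin> Q \<Longrightarrow> (v, nxt v) \<in> E \<and> Suc (d (nxt v)) = d v"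
  unfolding nxt_def by (rule someI_ex) (use step_exists in blast)

text \<open>The out-neighbours whose presence is certain. If there are no others, the digraph is the
  biclique together with a path from \<open>a\<close> to \<open>Q\<close>, provided that \<open>d w = k\<close>.\<close>

definition sure_nbrs :: "'a \<Rightarrow> 'a set" where
  "sure_nbrs u = (if u = a then insert w Q else if u \<in> P then Q else if u \<in> Q then P else {nxt u})"

lemma sure_nbrs_subset:
  assumes "u \<in> V"
  shows "sure_nbrs u \<subseteq> E `` {u}"
  using assms exit biclique nxt[OF assms] by (auto simp: sure_nbrs_def)

lemma sure_nbrs_ne: "sure_nbrs u \<noteq> {}"
  using Q_nonempty exit by (auto simp: sure_nbrs_def)

text \<open>The Perron vector of the extremal digraph, transplanted by means of the distance to \<open>Q\<close>.
  If \<open>c\<close> satisfies the equation for the Perron root of the extremal digraph, or only the inequality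
  \<open>\<le>\<close>, it is a subsolution on all of \<open>G\<close> (\<open>sure_nbrs_sum_ge\<close>).\<close>

definition test_vector :: "real \<Rightarrow> 'a \<Rightarrow> real" where
  "test_vector c u = (if u = a then (real q + (1 / (c - 1)) ^ k) / (c - real q - 1)
     else if u \<in> P then real q / (c - real q) else (1 / (c - 1)) ^ d u)"

text \<open>The second bound matters at the vertices of \<open>P\<close>, which are at distance 1: an out-neighbour in
  \<open>P\<close> contributes at least as much as a path vertex at the same distance would.\<close>

lemma test_vector_bounds:
  fixes c :: real
  assumes c: "real p + real q < c" and u: "u \<in> V"
  shows "0 < test_vector c u" "(1 / (c - 1)) ^ d u \<le> test_vector c u"
proof -
  have p1: "1 \<le> real p" and q1: "1 \<le> real q" using p_pos q_pos by auto
  have pos: "0 < c - q - 1" "0 < c - q" "0 < c - 1" using c p1 q1 by auto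
  let ?t = "1 / (c - 1)" and ?e = "(1 / (c - 1)) ^ k"
  have e: "0 < ?e" using pos by simp
  have y: "?t \<le> q / (c - q)"
  proof -
    have "c * (real q - 1) \<ge> 0" using pos q1 c by (intro mult_nonneg_nonneg) auto
    then have "c - real q \<le> real q * (c - 1)" by (simp add: algebra_simps)
    then show ?thesis using pos by (simp add: field_simps)
  qed
  have z: "q / (c - q) \<le> (q + ?e) / (c - q - 1)"
    using pos e q1 by (intro frac_le) auto
  show "0 < test_vector c u" using pos e q1 by (auto simp: test_vector_def intro!: divide_pos_pos add_pos_pos)
  show "?t ^ d u \<le> test_vector c u"
    using y z d_P[of u] exit(1) by (auto simp: test_vector_def)
qed

lemma sum_test_vector:
  fixes c :: real
  shows "sum (test_vector c) Q = q"
    and "sum (test_vector c) P = (q + (1 / (c - 1)) ^ k) / (c - q - 1) + (real p - 1) * (q / (c - q))"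
proof -
  have "test_vector c v = 1" if "v \<in> Q" for v
    using that exit(1) sides(2) d_Q by (auto simp: test_vector_def)
  then show "sum (test_vector c) Q = q" using card_sides by simp
  show "sum (test_vector c) P = (q + (1 / (c - 1)) ^ k) / (c - q - 1) + (real p - 1) * (q / (c - q))"
    using sum_biclique_side[OF finite_sides(1) exit(1), of "test_vector c" "q / (c - q)"] card_sides
    by (auto simp: test_vector_def)
qed

lemma test_vector_sums:
  fixes c :: real
  assumes c: "real p + real q < c"
  shows "(\<Sum>v \<in> sure_nbrs a. test_vector c a + test_vector c v) =
      c * test_vector c a + ((1 / (c - 1)) ^ d w - (1 / (c - 1)) ^ k)"
    and "u \<in> P - {a} \<Longrightarrow> (\<Sum>v \<in> sure_nbrs u. test_vector c u + test_vector c v) = c * test_vector c u"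
    and "u \<in> Q \<Longrightarrow> (c - q - 1) * (c - q) * ((\<Sum>v \<in> sure_nbrs u. test_vector c u + test_vector c v) -
       c * test_vector c u) =
      q + (1 / (c - 1)) ^ k * (c - q) - (c - q - 1) * (c * (c - p - q))"
    and "u \<in> R \<Longrightarrow> c * test_vector c u \<le> (\<Sum>v \<in> sure_nbrs u. test_vector c u + test_vector c v)"
proof -
  let ?x = "test_vector c" and ?t = "1 / (c - 1)"
  have p1: "1 \<le> real p" and q1: "1 \<le> real q" using p_pos q_pos by auto
  have pos: "0 < c - q - 1" "0 < c - q" "0 < c - 1" using c p1 q1 by auto
  have wa: "w \<noteq> a" "w \<notin> P" "w \<notin> Q" using exit by auto
  have xw: "?x w = ?t ^ d w" using wa by (simp add: test_vector_def)
  have "(\<Sum>v \<in> sure_nbrs a. ?x a + ?x v) = (q + 1) * ?x a + (?x w + q)"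
    using finite_sides card_sides wa sum_test_vector(1)
    by (simp add: sure_nbrs_def sum_add_const algebra_simps)
  moreover have "(c - q - 1) * ?x a = q + ?t ^ k" using pos by (simp add: test_vector_def)
  ultimately show "(\<Sum>v \<in> sure_nbrs a. ?x a + ?x v) = c * ?x a + (?t ^ d w - ?t ^ k)"
    using xw by (simp add: algebra_simps)
  show "(\<Sum>v \<in> sure_nbrs u. ?x u + ?x v) = c * ?x u" if u: "u \<in> P - {a}"
  proof -
    have "(\<Sum>v \<in> sure_nbrs u. ?x u + ?x v) = q * ?x u + q"
      using u finite_sides card_sides sum_test_vector(1) by (simp add: sure_nbrs_def sum_add_const)
    moreover have "(c - q) * ?x u = q" using pos u by (simp add: test_vector_def)
    ultimately show ?thesis by (simp add: algebra_simps)
  qed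
  show "(c - q - 1) * (c - q) * ((\<Sum>v \<in> sure_nbrs u. ?x u + ?x v) - c * ?x u) =
      q + ?t ^ k * (c - q) - (c - q - 1) * (c * (c - p - q))" if u: "u \<in> Q"
  proof -
    have u': "u \<noteq> a" "u \<notin> P" using u exit(1) sides(2) by auto
    then have xu: "?x u = 1" using d_Q[OF u] by (simp add: test_vector_def)
    have "(\<Sum>v \<in> sure_nbrs u. ?x u + ?x v) = p + sum ?x P"
      using u u' xu finite_sides card_sides by (simp add: sure_nbrs_def sum_add_const)
    then have "(\<Sum>v \<in> sure_nbrs u. ?x u + ?x v) - c * ?x u =
        p + (q + ?t ^ k) / (c - q - 1) + (real p - 1) * (q / (c - q)) - c"
      using xu sum_test_vector(2) by simp
    then show ?thesis using biclique_equation[of "real q" c "real p" "?t ^ k"] pos by simp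
  qed
  show "c * ?x u \<le> (\<Sum>v \<in> sure_nbrs u. ?x u + ?x v)" if u: "u \<in> R"
  proof -
    have u': "u \<noteq> a" "u \<notin> P" "u \<notin> Q" "u \<in> V" using u exit(1) by auto
    have n: "(u, nxt u) \<in> E" "Suc (d (nxt u)) = d u" using nxt u' by auto
    have "?x u = ?t ^ Suc (d (nxt u))" using u' n(2) by (simp add: test_vector_def)
    then have "(c - 1) * ?x u = ?t ^ d (nxt u)" using pos by simp
    also have "\<dots> \<le> ?x (nxt u)" using test_vector_bounds(2)[OF c] adj_in_verts(2)[OF n(1)] by blast
    finally show ?thesis using u' by (simp add: sure_nbrs_def algebra_simps)
  qed
qed

lemma sure_nbrs_sum_ge:
  fixes c :: real
  assumes c: "real p + real q < c"
    and ineq: "(c - q - 1) * (c * (c - p - q)) \<le> q + (1 / (c - 1)) ^ k * (c - q)"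
    and u: "u \<in> V"
  shows "c * test_vector c u \<le> (\<Sum>v \<in> sure_nbrs u. test_vector c u + test_vector c v)"
proof -
  have p1: "1 \<le> real p" and q1: "1 \<le> real q" using p_pos q_pos by auto
  have pos: "0 < c - q - 1" "0 < c - q" "1 \<le> c - 1" using c p1 q1 by auto
  consider "u = a" | "u \<in> P - {a}" | "u \<in> Q" | "u \<in> R" using u by blast
  then show ?thesis
  proof cases
    case 1
    have "(1 / (c - 1)) ^ k \<le> (1 / (c - 1)) ^ d w"
      using pos d_w_le by (intro power_decreasing) auto
    then show ?thesis using test_vector_sums(1)[OF c] 1 by simp
  next
    case 2
    then show ?thesis using test_vector_sums(2)[OF c] by simp
  next
    case 3
    have "0 \<le> (c - q - 1) * (c - q) *
        ((\<Sum>v \<in> sure_nbrs u. test_vector c u + test_vector c v) - c * test_vector c u)"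
      using test_vector_sums(3)[OF c 3] ineq by simp
    moreover have "0 < (c - q - 1) * (c - q)" using pos by simp
    ultimately show ?thesis unfolding zero_le_mult_iff by linarith
  qed (rule test_vector_sums(4)[OF c])
qed

lemma sure_nbrs_sum_le_qop:
  fixes c :: real
  assumes c: "real p + real q < c" and u: "u \<in> V"
  shows "(\<Sum>v \<in> sure_nbrs u. test_vector c u + test_vector c v) \<le> qop E (test_vector c) u"
    and "qop E (test_vector c) u \<le> (\<Sum>v \<in> sure_nbrs u. test_vector c u + test_vector c v) \<Longrightarrow>
      E `` {u} = sure_nbrs u"
proof -
  let ?g = "\<lambda>v. test_vector c u + test_vector c v"
  have sub: "E `` {u} \<subseteq> V" using arcs_ends_subset by auto
  then have fin: "finite (E `` {u})" using finite_verts by (rule finite_subset)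
  have g: "0 < ?g v" if "v \<in> E `` {u}" for v
    using test_vector_bounds(1)[OF c] u sub that by (blast intro: add_pos_pos)
  show "sum ?g (sure_nbrs u) \<le> qop E (test_vector c) u"
    unfolding qop_def using g less_imp_le by (intro sum_mono2[OF fin sure_nbrs_subset[OF u]]) blast
  assume le: "qop E (test_vector c) u \<le> sum ?g (sure_nbrs u)"
  show "E `` {u} = sure_nbrs u"
  proof (rule ccontr)
    assume "E `` {u} \<noteq> sure_nbrs u"
    then obtain v where "v \<in> E `` {u} - sure_nbrs u" using sure_nbrs_subset[OF u] by blast
    then have "sum ?g (sure_nbrs u) < sum ?g (E `` {u})"
      using g less_imp_le by (intro sum_strict_mono2[OF fin sure_nbrs_subset[OF u]]) blast+
    then show False using le by (simp add: qop_def)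
  qed
qed

lemma q_index_ge_root:
  fixes c :: real
  assumes c: "real p + real q < c"
    and ineq: "(c - q - 1) * (c * (c - p - q)) \<le> q + (1 / (c - 1)) ^ k * (c - q)"
  shows "c \<le> q_index G"
proof (rule q_index_ge[of "test_vector c"])
  show "V \<noteq> {}" using w_R by blast
  fix u assume u: "u \<in> V"
  show "0 < test_vector c u" by (rule test_vector_bounds(1)[OF c u])
  show "c * test_vector c u \<le> qop E (test_vector c) u"
    using sure_nbrs_sum_ge[OF c ineq u] sure_nbrs_sum_le_qop(1)[OF c u] by linarith
qed

text \<open>If the bound is attained, the test vector is an eigenvector, so every estimate used for it is an
  equality: at \<open>Q\<close> this is the root equation, at \<open>a\<close> it gives \<open>d w = k\<close>, and no vertex has an
  out-neighbour beyond the sure ones.\<close>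

lemma q_index_eq_root:
  fixes c :: real
  assumes c: "real p + real q < c"
    and ineq: "(c - q - 1) * (c * (c - p - q)) \<le> q + (1 / (c - 1)) ^ k * (c - q)"
    and eq: "q_index G = c"
  shows "(c - q - 1) * (c * (c - p - q)) = q + (1 / (c - 1)) ^ k * (c - q)"
    and "d w = k"
    and "\<And>u. u \<in> V \<Longrightarrow> E `` {u} = sure_nbrs u"
proof -
  let ?x = "test_vector c"
  have p1: "1 \<le> real p" and q1: "1 \<le> real q" using p_pos q_pos by auto
  have ge: "c * ?x u \<le> qop E ?x u" if "u \<in> V" for u
    using sure_nbrs_sum_ge[OF c ineq that] sure_nbrs_sum_le_qop(1)[OF c that] by linarith
  have out: "E `` {u} \<noteq> {}" if "u \<in> V" for u using sure_nbrs_ne[of u] sure_nbrs_subset[OF that] by blast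
  have Qx: "qop E ?x u = c * ?x u" if "u \<in> V" for u
    using qop_eq_of_q_index_eq[OF sc out test_vector_bounds(1)[OF c] ge eq that] by blast
  have sum_eq: "(\<Sum>v \<in> sure_nbrs u. ?x u + ?x v) = c * ?x u" if "u \<in> V" for u
    using sure_nbrs_sum_ge[OF c ineq that] sure_nbrs_sum_le_qop(1)[OF c that] Qx[OF that] by linarith
  show "E `` {u} = sure_nbrs u" if "u \<in> V" for u
    using sure_nbrs_sum_le_qop(2)[OF c that] sum_eq[OF that] Qx[OF that] by simp
  have a: "a \<in> V" using exit(1) sides by blast
  have t: "1 / (c - 1) < 1" "0 < 1 / (c - 1)" using c p1 q1 by auto
  have "(1 / (c - 1)) ^ d w = (1 / (c - 1)) ^ k"
    using test_vector_sums(1)[OF c] sum_eq[OF a] by simp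
  then show "d w = k"
    using power_strict_decreasing[OF _ t(2,1), of "d w" k] d_w_le by (cases "d w < k") auto
  obtain b where b: "b \<in> Q" "b \<in> V" using Q_nonempty sides by blast
  show "(c - q - 1) * (c * (c - p - q)) = q + (1 / (c - 1)) ^ k * (c - q)"
    using test_vector_sums(3)[OF c b(1)] sum_eq[OF b(2)] by simp
qed

end

section \<open>The equality case determines the digraph\<close>

lemma bij_betw_interval_pinned:
  assumes "finite A" "card A = m" "a \<in> A"
  obtains h where "bij_betw h A {c + 1..c + m}" "h a = c + 1"
proof -
  have "0 < card A" using assms(1,3) card_gt_0_iff[of A] by blast
  then have m: "1 \<le> m" using assms(2) by simp
  have "card (A - {a}) = card {c + 2..c + m}" using assms by simp
  then obtain g where g: "bij_betw g (A - {a}) {c + 2..c + m}"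
    using finite_same_card_bij[of "A - {a}" "{c + 2..c + m}"] assms(1) by auto
  have "bij_betw (g(a := c + 1)) (A - {a}) {c + 2..c + m}"
    using g bij_betw_cong[of "A - {a}" g "g(a := c + 1)"] by simp
  moreover have "bij_betw (g(a := c + 1)) {a} {c + 1}" by simp
  ultimately have "bij_betw (g(a := c + 1)) ((A - {a}) \<union> {a}) ({c + 2..c + m} \<union> {c + 1})"
    by (rule bij_betw_combine) auto
  moreover have "(A - {a}) \<union> {a} = A" "{c + 2..c + m} \<union> {c + 1} = {c + 1..c + m}"
    using assms(3) m by auto
  ultimately show ?thesis using that by simp
qed

context biclique_exit
begin

text \<open>Outside the biclique the vertex at distance \<open>m\<close> from \<open>Q\<close> is then unique; it is the vertex
  number \<open>p + q + k + 1 - m\<close> of the extremal digraph.\<close>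

lemma digraph_iso_B5:
  assumes nbrs: "\<And>u. u \<in> V \<Longrightarrow> E `` {u} = sure_nbrs u"
    and dw: "d w = k"
  shows "digraph_iso G (with_proj (B5 (p + q + k) p q))"
proof -
  have a: "a \<in> V" using exit(1) sides by blast
  have R_not: "u \<noteq> a" "u \<notin> P" "u \<notin> Q" "u \<in> V" if "u \<in> R" for u using that exit(1) by auto
  have nbrs_R: "E `` {u} = {nxt u}" if "u \<in> R" for u
    using nbrs R_not[OF that] by (simp add: sure_nbrs_def)
  have nxt_R: "nxt u \<in> V" "Suc (d (nxt u)) = d u" if "u \<in> R" for u
    using nxt[of u] R_not[OF that] adj_in_verts(2) by blast+
  have orbit: "v \<in> R \<longrightarrow> d v \<le> k \<and> v = (nxt ^^ (k - d v)) w" if "v \<in> V" for v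
    using reach[OF a that]
  proof (induction rule: rtrancl_induct)
    case base
    then show ?case using exit(1) by blast
  next
    case (step u v)
    show ?case
    proof
      assume v: "v \<in> R"
      have uV: "u \<in> V" using step(2) adj_in_verts by blast
      have uv: "v \<in> sure_nbrs u" using nbrs[OF uV] step(2) by blast
      show "d v \<le> k \<and> v = (nxt ^^ (k - d v)) w"
      proof (cases "u \<in> R")
        case True
        then have "v = nxt u" using uv R_not[OF True] by (simp add: sure_nbrs_def)
        moreover have "k - d (nxt u) = Suc (k - d u)" "d u \<le> k"
          using nxt_R(2)[OF True] step.IH True by auto
        ultimately show ?thesis using step.IH True nxt_R(2)[OF True] by auto
      next
        case False
        then have "v = w" using uv v uV by (auto simp: sure_nbrs_def split: if_splits)
        then show ?thesis using dw by simp
      qed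
    qed
  qed
  have d_inj: "u = v" if "u \<in> R" "v \<in> R" "d u = d v" for u v
    using orbit[of u] orbit[of v] that by (metis DiffD1)
  then have injR: "inj_on d R" by (rule inj_onI)
  have dR: "1 \<le> d v" "d v \<le> k" if "v \<in> R" for v using orbit[of v] d_R[OF that] that by blast+
  then have "d ` R \<subseteq> {1..k}" by (intro image_subsetI) (simp only: atLeastAtMost_iff)
  moreover have "card (d ` R) = card {1..k}" using card_image[OF injR] card_R by simp
  ultimately have imgR: "d ` R = {1..k}" by (intro card_subset_eq) auto
  then obtain l where l: "l \<in> R" "d l = 1" using k_pos by (metis atLeastAtMost_iff image_iff order_refl)
  define b where "b = nxt l"
  have b: "b \<in> Q" using nxt_R[OF l(1)] l(2) d_eq_0_iff unfolding b_def by simp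
  obtain hP where "bij_betw hP P {0 + 1..0 + p}" "hP a = 0 + 1"
    using bij_betw_interval_pinned[OF finite_sides(1) card_sides(1) exit(1)] .
  then have hP: "bij_betw hP P {1..p}" "hP a = 1" by simp_all
  obtain hQ where hQ: "bij_betw hQ Q {p + 1..p + q}" "hQ b = p + 1"
    using bij_betw_interval_pinned[OF finite_sides(2) card_sides(2) b] .
  define f where "f v = (if v \<in> P then hP v else if v \<in> Q then hQ v else p + q + k + 1 - d v)" for v
  have fP: "f v = hP v" if "v \<in> P" for v using that by (simp add: f_def)
  have fQ: "f v = hQ v" if "v \<in> Q" for v using that sides(2) by (auto simp: f_def)
  have fR: "f v = p + q + k + 1 - d v" if "v \<in> R" for v using that by (simp add: f_def)
  have bP: "bij_betw f P {1..p}" using hP(1) fP bij_betw_cong[of P f hP] by blast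
  have bQ: "bij_betw f Q {p + 1..p + q}" using hQ(1) fQ bij_betw_cong[of Q f hQ] by blast
  have "bij_betw f R {p + q + 1..p + q + k}"
    unfolding bij_betw_def
  proof
    show "inj_on f R"
    proof (rule inj_onI)
      fix u v assume *: "u \<in> R" "v \<in> R" "f u = f v"
      then have "d u = d v" using dR[of u] dR[of v] fR[of u] fR[of v] by linarith
      then show "u = v" using d_inj * by blast
    qed
    then have "card (f ` R) = card {p + q + 1..p + q + k}" using card_R by (simp add: card_image)
    moreover have "f ` R \<subseteq> {p + q + 1..p + q + k}" using dR fR by fastforce
    ultimately show "f ` R = {p + q + 1..p + q + k}" by (intro card_subset_eq) auto
  qed
  then have "bij_betw f ((P \<union> Q) \<union> R) (({1..p} \<union> {p + 1..p + q}) \<union> {p + q + 1..p + q + k})"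
    using bP bQ by (intro bij_betw_combine) auto
  moreover have "(P \<union> Q) \<union> R = V" using sides by blast
  moreover have "({1..p} \<union> {p + 1..p + q}) \<union> {p + q + 1..p + q + k} = {1..p + q + k}" by auto
  ultimately have bV: "bij_betw f V {1..p + q + k}" by simp
  have rP: "f v \<in> {1..p}" if "v \<in> P" for v using bP that bij_betwE by blast
  have rQ: "f v \<in> {p + 1..p + q}" if "v \<in> Q" for v using bQ that bij_betwE by blast
  have rR: "f v \<in> {p + q + 1..p + q + k}" if "v \<in> R" for v using dR[OF that] fR[OF that] by auto
  have f_eq: "f u = f v \<longleftrightarrow> u = v" if "u \<in> V" "v \<in> V" for u v
    using bV that by (auto simp: bij_betw_def dest: inj_onD)
  have fa: "f a = 1" and fb: "f b = p + 1" and fw: "f w = p + q + 1" and fl: "f l = p + q + k"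
    using fP[OF exit(1)] hP(2) fQ[OF b] hQ(2) fR[OF w_R] dw fR[OF l(1)] l(2) by auto
  show ?thesis
  proof (rule digraph_iso_with_projI[of f])
    show "bij_betw f V (pverts (B5 (p + q + k) p q))" unfolding pverts_B5 by (rule bV)
    show "parcs (B5 (p + q + k) p q) \<subseteq> pverts (B5 (p + q + k) p q) \<times> pverts (B5 (p + q + k) p q)"
      using p_pos q_pos k_pos unfolding pverts_B5 by (auto simp: B5_arcs_iff)
    fix u v assume u: "u \<in> V" and v: "v \<in> V"
    have E_iff: "(u, v) \<in> E \<longleftrightarrow> v \<in> sure_nbrs u" using nbrs[OF u] by blast
    have v_iff: "f v \<in> {1..p} \<longleftrightarrow> v \<in> P" "f v \<in> {p + 1..p + q} \<longleftrightarrow> v \<in> Q"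
      using rP[of v] rQ[of v] rR[of v] v by force+
    consider "u = a" | "u \<in> P" "u \<noteq> a" | "u \<in> Q" | "u \<in> R" "u \<noteq> l" | "u = l" using u by blast
    then show "(u, v) \<in> E \<longleftrightarrow> (f u, f v) \<in> parcs (B5 (p + q + k) p q)"
    proof cases
      case 1
      have "v = w \<longleftrightarrow> f v = p + q + 1" using f_eq[OF v, of w] w_R fw by auto
      then show ?thesis unfolding E_iff B5_arcs_iff
        using 1 fa v_iff p_pos q_pos k_pos by (auto simp: sure_nbrs_def)
    next
      case 2
      then have "f u \<in> {1..p}" "f u \<noteq> 1" using rP f_eq[OF u a] fa by auto
      then show ?thesis unfolding E_iff B5_arcs_iff
        using 2 v_iff q_pos k_pos by (auto simp: sure_nbrs_def)
    next
      case 3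
      then have "f u \<in> {p + 1..p + q}" "u \<noteq> a" "u \<notin> P" using rQ exit(1) sides(2) by auto
      then show ?thesis unfolding E_iff B5_arcs_iff
        using 3 v_iff p_pos k_pos by (auto simp: sure_nbrs_def)
    next
      case 4
      have "d u \<noteq> 1" using d_inj[OF 4(1) l(1)] 4(2) l(2) by auto
      then have du: "2 \<le> d u" "d u \<le> k" using dR[OF 4(1)] by auto
      have "d u - 1 \<in> d ` R" unfolding imgR using du by auto
      then obtain v' where "d u - 1 = d v'" "v' \<in> R" by (rule imageE)
      then have v': "v' \<in> R" "d v' = d u - 1" by simp_all
      have "v' = (nxt ^^ (k - d v')) w" "u = (nxt ^^ (k - d u)) w"
        using orbit[of v'] orbit[of u] v'(1) 4(1) by auto
      moreover have "k - d v' = Suc (k - d u)" using v'(2) du by simp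
      ultimately have "v' = nxt u" by simp
      then have "f (nxt u) = f u + 1" using fR[OF v'(1)] fR[OF 4(1)] v'(2) du by simp
      moreover have "nxt u \<in> V" using v'(1) \<open>v' = nxt u\<close> by blast
      ultimately have "v = nxt u \<longleftrightarrow> f v = f u + 1" using f_eq[OF v] by metis
      moreover have "f u \<in> {p + q + 1..p + q + k - 1}" using fR[OF 4(1)] du by auto
      ultimately show ?thesis unfolding E_iff B5_arcs_iff
        using R_not[OF 4(1)] k_pos p_pos by (auto simp: sure_nbrs_def)
    next
      case 5
      have "b \<in> V" using b sides by blast
      then have "v = b \<longleftrightarrow> f v = p + 1" using f_eq[OF v] fb by metis
      then show ?thesis unfolding E_iff B5_arcs_iff
        using R_not[OF l(1)] 5 fl b_def k_pos by (auto simp: sure_nbrs_def)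
    qed
  qed
qed

end

section \<open>Finding the exit arc\<close>

lemma digraph_class_biclique:
  assumes "G \<in> digraph_class n p q"
  obtains P Q where "P \<union> Q \<subseteq> verts G" "P \<inter> Q = {}" "card P = p" "card Q = q"
    "\<forall>u\<in>P. \<forall>v\<in>Q. (u, v) \<in> arcs_ends G \<and> (v, u) \<in> arcs_ends G"
proof -
  obtain H where H: "subgraph H G" "digraph_iso H (with_proj (complete_bipartite p q))"
    using assms by (auto simp: digraph_class_def)
  let ?K = "complete_bipartite p q"
  obtain f where f: "bij_betw f (verts H) (pverts ?K)"
    and K: "parcs ?K = (\<lambda>(u, v). (f u, f v)) ` arcs_ends H"
    using digraph_iso_with_projE[OF H(2)] .
  have K_verts: "pverts ?K = {1..p + q}" by (simp add: complete_bipartite_def)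
  have wf: "wf_digraph H" and sub: "verts H \<subseteq> verts G" "arcs_ends H \<subseteq> arcs_ends G"
    using H(1) by (auto simp: subgraph_def compatible_def arcs_ends_conv)
  have inj: "inj_on f (verts H)" and img: "f ` verts H = {1..p + q}"
    using f K_verts by (auto simp: bij_betw_def)
  define P where "P = {v \<in> verts H. f v \<in> {1..p}}"
  define Q where "Q = {v \<in> verts H. f v \<in> {p + 1..p + q}}"
  have arc: "(u, v) \<in> arcs_ends G" if "u \<in> verts H" "v \<in> verts H" "(f u, f v) \<in> parcs ?K" for u v
  proof -
    have "(f u, f v) \<in> (\<lambda>(u, v). (f u, f v)) ` arcs_ends H" using that(3) K by simp
    then obtain u' v' where "(u', v') \<in> arcs_ends H" "f u' = f u" "f v' = f v" by auto
    moreover from this have "u' \<in> verts H" "v' \<in> verts H" using wf_digraph.adj_in_verts[OF wf] by blast+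
    ultimately show ?thesis using that(1,2) inj sub(2) by (metis inj_onD subsetD)
  qed
  show ?thesis
  proof (rule that[of P Q])
    show "P \<union> Q \<subseteq> verts G" using sub by (auto simp: P_def Q_def)
    show "P \<inter> Q = {}" by (auto simp: P_def Q_def)
    have injPQ: "inj_on f P" "inj_on f Q" by (rule inj_on_subset[OF inj]; auto simp: P_def Q_def)+
    have "{1..p} \<subseteq> f ` verts H" "{p + 1..p + q} \<subseteq> f ` verts H" unfolding img by auto
    then have "f ` P = {1..p}" "f ` Q = {p + 1..p + q}" unfolding P_def Q_def by auto
    then show "card P = p" "card Q = q" using card_image[OF injPQ(1)] card_image[OF injPQ(2)] by simp_all
    show "\<forall>u\<in>P. \<forall>v\<in>Q. (u, v) \<in> arcs_ends G \<and> (v, u) \<in> arcs_ends G"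
      by (auto simp: P_def Q_def complete_bipartite_def intro!: arc)
  qed
qed

lemma (in digraph) strongly_connected_exit_arc:
  assumes "strongly_connected G" "S \<subseteq> verts G" "S \<noteq> {}" "S \<noteq> verts G"
  obtains u v where "u \<in> S" "v \<notin> S" "(u, v) \<in> arcs_ends G"
proof -
  obtain s t where st: "s \<in> S" "t \<in> verts G" "t \<notin> S" using assms by blast
  then have "(s, t) \<in> (arcs_ends G)\<^sup>*"
    using assms(1,2) reachable_rtranclI by (metis strongly_connected_def subsetD)
  then have "t \<notin> S \<Longrightarrow> \<exists>u v. u \<in> S \<and> v \<notin> S \<and> (u, v) \<in> arcs_ends G"
    using st(1) by (induction rule: rtrancl_induct) blast+
  then show ?thesis using st(3) that by blast
qed

section \<open>The lower bound and its equality case\<close>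

theorem theorem3p8:
  fixes G :: "('a, 'b) pre_digraph" and n p q :: nat
  assumes "p \<ge> q" and "q \<ge> 1"
    and "p + q + 1 \<le> n"
    and "[n = p + q] (mod 2)"
    and "G \<in> digraph_class n p q"
  shows "q_index G \<ge> q_index (with_proj (B5 n p q)) \<and>
    (q_index G = q_index (with_proj (B5 n p q)) \<longleftrightarrow> digraph_iso G (with_proj (B5 n p q)))"
proof -
  define k where "k = n - p - q"
  have n: "n = p + q + k" and k: "1 \<le> k" using assms(3) by (auto simp: k_def)
  have even_k: "even k" using assms(4) unfolding n cong_def by presburger
  have p: "1 \<le> p" using assms by simp
  let ?B = "with_proj (B5 n p q)"
  interpret digraph G using assms(5) by (simp add: digraph_class_def)
  have sc: "strongly_connected G" and bip: "bipartite_digraph G" and card: "card (verts G) = p + q + k"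
    using assms(5) n by (auto simp: digraph_class_def)
  obtain c :: real where c: "real p + real q < c"
    and root: "(c - q - 1) * (c * (c - p - q)) = q + (1 / (c - 1)) ^ k * (c - q)"
    using B5_root_exists[OF p assms(2)] .
  have qB: "q_index ?B = c" unfolding n by (rule q_index_B5[OF p assms(2) k c root])
  have iso_imp: "q_index G = c" if "digraph_iso G ?B"
    using q_index_eq_of_iso[OF that[unfolded n], of "B5_vector k p q c" c]
      B5_eigenvector[OF p assms(2) k c root] p by (auto simp: pverts_B5)
  obtain P Q where PQ: "P \<union> Q \<subseteq> verts G" "P \<inter> Q = {}" "card P = p" "card Q = q"
    and biclique: "\<forall>u\<in>P. \<forall>v\<in>Q. (u, v) \<in> arcs_ends G \<and> (v, u) \<in> arcs_ends G"
    using digraph_class_biclique[OF assms(5)] .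
  have fin: "finite P" "finite Q" using PQ(1) finite_verts by (auto intro: finite_subset)
  have "P \<union> Q \<noteq> verts G" using card_Un_disjoint[OF fin PQ(2)] PQ(3,4) card k by auto
  moreover have "P \<union> Q \<noteq> {}" using PQ(3) p by auto
  ultimately obtain a w where aw: "a \<in> P \<union> Q" "w \<notin> P \<union> Q" "(a, w) \<in> arcs_ends G"
    using strongly_connected_exit_arc[OF sc PQ(1)] by metis
  have "c \<le> q_index G \<and> (q_index G = c \<longrightarrow> digraph_iso G ?B)"
  proof (cases "a \<in> P")
    case True
    interpret biclique_exit G P Q a w p q k
      by unfold_locales (use sc bip PQ biclique aw True card even_k assms(2) in auto)
    show ?thesis
      using q_index_ge_root[OF c] q_index_eq_root(2,3)[OF c] digraph_iso_B5 root unfolding n by auto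
  next
    case False
    interpret biclique_exit G Q P a w q p k
      by unfold_locales (use sc bip PQ biclique aw False card even_k p in auto)
    have c': "real q + real p < c" using c by simp
    have e: "0 < (1 / (c - 1)) ^ k" using c p assms(2) by simp
    note swap = root_swap[of "real p" "real q" c "(1 / (c - 1)) ^ k", OF c _ _ e root]
    have ineq: "(c - p - 1) * (c * (c - q - p)) \<le> p + (1 / (c - 1)) ^ k * (c - p)"
      using swap(1) assms(1,2) by simp
    have "digraph_iso G ?B" if "q_index G = c"
    proof -
      have "p = q" using swap(2) q_index_eq_root(1)[OF c' ineq that] assms(1,2) by simp
      then show ?thesis using digraph_iso_B5 q_index_eq_root(2,3)[OF c' ineq that] unfolding n by simp
    qed
    then show ?thesis using q_index_ge_root[OF c' ineq] by blast
  qed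
  then show ?thesis using qB iso_imp by auto
qed

end
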